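(* Let $V$, $H$, $X=X_1\times\dots\times X_N$ be as in the context, and let $f_1,\dots,f_N:X\to\mathbb{R}$ satisfy: (a) $f_1,\dots,f_N$ are weakly lower semicontinuous on $X$; (b) for each $x\in X$, the function $X\ni y\mapsto \sum_{j=1}^N f_j(y_j,x_{-j})$ is convex; (c) for each $y\in X$, the function $X\ni x\mapsto \sum_{j=1}^N f_j(y_j,x_{-j})$ is weakly continuous; (d) there is $\theta>0$ such that $\sum_{j=1}^N (p_j-q_j,x_j-y_j)\ge \theta\|x-y\|^2$ for all $x,y\in X$ and all $p_j\in\partial_{x_j}f_j(x)$, $q_j\in\partial_{x_j}f_j(y)$ $(j=1,\dots,N)$. Then $f_1,\dots,f_N$ has a unique Nash equilibrium $z\in X$. Moreover, if $u:[0,\infty)\to H^N$ is Lipschitz continuous with $u(t)\in\mathcal{D}$ for each $t\ge0$ and satisfies $$u(0)=u^0\in\mathcal{D},\qquad \sum_{j=1}^N(\dot u_j(t)+\partial_{x_j}f_j(u(t)),\,y_j-u_j(t))\ge 0\ \text{ for a.e. } t\ge 0 \text{ and each } y\in X,$$ then there is $\lambda>0$ such that $|u(t)-z|\le e^{-\lambda t}|u(0)-z|$ for each $t\ge0$.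
   Context: $V$ is a real reflexive Banach space with norm $\|\cdot\|$, continuous dual $V^*$ and duality pairing $(\cdot,\cdot)$; on $V^N$, $\|x\|=(\sum_j\|x_j\|^2)^{1/2}$. $X_1,\dots,X_N\subset V$ are closed and convex with nonempty interiors, and $X:=X_1\times\dots\times X_N\subset V^N$. "Weakly" on $X$ refers to the weak topology of $V^N$. If $V$ is finite dimensional, $V=H=V^*$ is identified with a Euclidean space. If $V$ is infinite dimensional, $H$ is a real Hilbert space with inner product $\langle\cdot,\cdot\rangle$ such that $V\subset H\subset V^*$, with $V\subset H$ continuously embedded; $y\in H$ is regarded as the element of $V^*$ given by $(y,x)=\langle y,x\rangle$, $x\in V$. $|\cdot|$ denotes the norm of $H$ and the product norm $|x|=(\sum_j|x_j|^2)^{1/2}$ of $H^N$. For $x\in X$ and $y_j\in X_j$, $(y_j,x_{-j})$ is the point of $X$ obtained from $x$ by replacing the $j$-th coordinate $x_j$ by $y_j$. A Nash equilibrium of $f_1,\dots,f_N$ is $x\in X$ with $f_j(x)\le f_j(y_j,x_{-j})$ for all $y_j\in X_j$ and all $j$. For $x\in X$, $\partial_{x_j}f_j(x):=\{\zeta\in V^*: f_j(z,x_{-j})\ge f_j(x)+(\zeta,z-x_j)\ \text{for all } z\in X_j\}$. The normal cone is $n_{X_j}(z):=\{\zeta\in V^*:(\zeta,y-z)\le 0 \text{ for all } y\in X_j\}$. $\mathcal{D}:=\{x\in X: (\partial_{x_j}f_j(x)+n_{X_j}(x_j))\cap H\ne\emptyset \text{ for each } j=1,\dots,N\}$. The inequality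 in the initial value problem means: for a.e. $t\ge0$, $u(t)\in X$ and there are $p_j\in\partial_{x_j}f_j(u(t))$, $j=1,\dots,N$, with $\sum_{j}(\dot u_j(t)+p_j,y_j-u_j(t))\ge0$ for every $y\in X$; equivalently $-\dot u_j(t)\in\partial_{x_j}f_j(u(t))+n_{X_j}(u_j(t))$ for each $j$. *)

theory Defs
  imports "HOL-Analysis.Analysis"
begin

text \<open>
  The dual of \<open>'v\<close> is the type \<open>'v \<Rightarrow>\<^sub>L real\<close>, and the pairing is function application.
  The spaces \<open>V\<^sup>N\<close> and \<open>H\<^sup>N\<close> are \<open>'v ^ 'n\<close> and \<open>'h ^ 'n\<close>, with \<open>'n\<close> the
  type of players; the library norm on these types is the Euclidean combination of the norms
  of the coordinates.
\<close>

definition reflexive_space :: "'v::real_normed_vector itself \<Rightarrow> bool" where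
  "reflexive_space _ \<longleftrightarrow>
    (\<forall>\<phi> :: ('v \<Rightarrow>\<^sub>L real) \<Rightarrow>\<^sub>L real. \<exists>x :: 'v. \<forall>\<zeta>. blinfun_apply \<phi> \<zeta> = blinfun_apply \<zeta> x)"

definition weak_topology :: "'a::real_normed_vector topology" where
  "weak_topology =
    topology_generated_by {blinfun_apply \<phi> -` U | (\<phi> :: 'a \<Rightarrow>\<^sub>L real) U. open U}"

definition weakly_continuous_on :: "'a::real_normed_vector set \<Rightarrow> ('a \<Rightarrow> real) \<Rightarrow> bool" where
  "weakly_continuous_on S g \<longleftrightarrow> continuous_map (subtopology weak_topology S) euclideanreal g"

definition weakly_lsc_on :: "'a::real_normed_vector set \<Rightarrow> ('a \<Rightarrow> real) \<Rightarrow> bool" where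
  "weakly_lsc_on S g \<longleftrightarrow>
    (\<forall>c. openin (subtopology weak_topology S) {x \<in> S. c < g x})"

text \<open>
  The inclusion of \<open>V\<close> in \<open>H\<close> is an injective bounded linear map \<open>\<iota>\<close>.
  The element of \<open>V\<^sup>*\<close> represented by \<open>y\<close> in \<open>H\<close> is then \<open>x \<mapsto> y \<bullet> \<iota> x\<close>,
  and the inclusion of \<open>H\<close> in \<open>V\<^sup>*\<close> says that this representation is injective (equivalently,
  that \<open>\<iota>\<close> has dense range).  If \<open>V\<close> is finite dimensional this forces \<open>\<iota>\<close> to be an isomorphism;
  the case \<open>V = H = V\<^sup>*\<close> is that of the identity.
\<close>

definition to_dual :: "('v::real_normed_vector \<Rightarrow>\<^sub>L 'h::real_inner) \<Rightarrow> 'h \<Rightarrow> ('v \<Rightarrow>\<^sub>L real)" where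
  "to_dual \<iota> y = blinfun_inner_right y o\<^sub>L \<iota>"

definition embedded_triple :: "('v::real_normed_vector \<Rightarrow>\<^sub>L 'h::real_inner) \<Rightarrow> bool" where
  "embedded_triple \<iota> \<longleftrightarrow> inj (blinfun_apply \<iota>) \<and> inj (to_dual \<iota>)"

definition embed_prod :: "('v::real_normed_vector \<Rightarrow>\<^sub>L 'h::real_normed_vector) \<Rightarrow> 'v ^ 'n \<Rightarrow> 'h ^ 'n" where
  "embed_prod \<iota> x = (\<chi> j. blinfun_apply \<iota> (x $ j))"

definition strategies :: "('n \<Rightarrow> 'v set) \<Rightarrow> ('v ^ 'n) set" where
  "strategies Xs = {x. \<forall>j. x $ j \<in> Xs j}"

definition replace_coord :: "'v ^ 'n \<Rightarrow> 'n \<Rightarrow> 'v \<Rightarrow> 'v ^ 'n" where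
  "replace_coord x j w = (\<chi> k. if k = j then w else x $ k)"

definition nash_equilibrium ::
  "('n \<Rightarrow> 'v set) \<Rightarrow> ('n \<Rightarrow> 'v ^ 'n \<Rightarrow> real) \<Rightarrow> 'v ^ 'n \<Rightarrow> bool" where
  "nash_equilibrium Xs f x \<longleftrightarrow>
    x \<in> strategies Xs \<and> (\<forall>j. \<forall>w\<in>Xs j. f j x \<le> f j (replace_coord x j w))"

definition partial_subdiff ::
  "('n \<Rightarrow> 'v::real_normed_vector set) \<Rightarrow> ('n \<Rightarrow> 'v ^ 'n \<Rightarrow> real) \<Rightarrow> 'n \<Rightarrow> 'v ^ 'n \<Rightarrow> ('v \<Rightarrow>\<^sub>L real) set"
  where
  "partial_subdiff Xs f j x =
    {\<zeta>. \<forall>w\<in>Xs j. f j (replace_coord x j w) \<ge> f j x + blinfun_apply \<zeta> (w - x $ j)}"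

definition normal_cone :: "'v::real_normed_vector set \<Rightarrow> 'v \<Rightarrow> ('v \<Rightarrow>\<^sub>L real) set" where
  "normal_cone C z = {\<zeta>. \<forall>y\<in>C. blinfun_apply \<zeta> (y - z) \<le> 0}"

definition evolution_domain ::
  "('v::real_normed_vector \<Rightarrow>\<^sub>L 'h::real_inner) \<Rightarrow> ('n \<Rightarrow> 'v set) \<Rightarrow> ('n \<Rightarrow> 'v ^ 'n \<Rightarrow> real) \<Rightarrow> ('v ^ 'n) set"
  where
  "evolution_domain \<iota> Xs f =
    {x \<in> strategies Xs. \<forall>j.
      {p + \<nu> | p \<nu>. p \<in> partial_subdiff Xs f j x \<and> \<nu> \<in> normal_cone (Xs j) (x $ j)}
        \<inter> range (to_dual \<iota>) \<noteq> {}}"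

text \<open>
  Here \<open>x\<close> is the element of \<open>V\<^sup>N\<close> that is identified with \<open>u t\<close>, and \<open>du\<close> is the
  derivative of \<open>u\<close> at \<open>t\<close> in \<open>H\<^sup>N\<close>, whose existence for almost every \<open>t\<close> is part of the
  meaning of the inequality.
\<close>

definition solves_variational_ineq ::
  "('v::real_normed_vector \<Rightarrow>\<^sub>L 'h::real_inner) \<Rightarrow> ('n::finite \<Rightarrow> 'v set) \<Rightarrow> ('n \<Rightarrow> 'v ^ 'n \<Rightarrow> real)
    \<Rightarrow> (real \<Rightarrow> 'h ^ 'n) \<Rightarrow> bool"
  where
  "solves_variational_ineq \<iota> Xs f u \<longleftrightarrow>
    (AE t in lborel. t \<ge> 0 \<longrightarrow>
      (\<exists>x\<in>strategies Xs. \<exists>du p.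
        u t = embed_prod \<iota> x \<and>
        (u has_vector_derivative du) (at t within {0..}) \<and>
        (\<forall>j. p j \<in> partial_subdiff Xs f j x) \<and>
        (\<forall>y\<in>strategies Xs.
          (\<Sum>j\<in>UNIV. blinfun_apply (to_dual \<iota> (du $ j) + p j) (y $ j - x $ j)) \<ge> 0)))"

end

theory Submission
  imports Defs
begin

text \<open>
  Write \<open>X\<close> for the set of strategies and \<open>F x y\<close> for the sum of the costs \<open>f j\<close> at the points
  that arise from \<open>x\<close> when player \<open>j\<close> alone changes to \<open>y $ j\<close>.  A point \<open>z\<close> of \<open>X\<close> is a
  Nash equilibrium if and only if it minimises \<open>F z\<close> over \<open>X\<close>
  (\<open>nash_equilibrium_iff_total_cost\<close>), and in that case zero belongs to the partial
  subdifferential of each player at \<open>z\<close>.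

  Uniqueness and decay are consequences of this last remark.  For two equilibria, strong
  monotonicity with zero subgradients leaves no distance.  Along the flow, the variational
  inequality tested with \<open>z\<close> and strong monotonicity against the zero subgradient at \<open>z\<close> bound
  the inner product of \<open>u'\<close> and \<open>u - z\<close> by \<open>- \<theta> * (norm (x - z))\<^sup>2\<close> in the norm of \<open>V\<close>, where
  \<open>x\<close> is the element of \<open>V\<^sup>N\<close> identified with \<open>u t\<close>; the norm of \<open>H\<close> is smaller up to a factor,
  which gives the rate.  Since \<open>u\<close> is Lipschitz continuous, the inequality almost everywhere
  can be integrated
  (\<open>lipschitz_curve_exponential_decay\<close>).

  For existence, strong monotonicity allows an argument in the style of Minty, with convexity and
  compactness in place of a fixed point theorem.
  At interior points \<open>y\<close> of \<open>X\<close> the convex lower semicontinuous function \<open>F y\<close>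
  has a subgradient \<open>q\<close> at \<open>y\<close> (\<open>convex_lsc_has_subgradient\<close>), and the components of \<open>q\<close> are
  subgradients for the single players.  The sets of all \<open>z\<close> in \<open>X\<close> with
  \<open>q (y - z) \<ge> \<theta> / 2 * (norm (y - z))\<^sup>2\<close> are closed, convex and bounded.  Finitely many of them
  have a common point by an elementary minimisation over the convex hull of the points \<open>y\<close>
  (\<open>concave_family_common_nonneg_point\<close>), and by reflexivity all of them have one
  (\<open>reflexive_bounded_closed_convex_fip\<close>).  Moving from this point \<open>z\<close> towards interior points
  and using the continuity of \<open>F\<close> in its first argument turns the inequality into the minimality
  of \<open>z\<close> (\<open>nash_equilibrium_exists\<close>).
\<close>

section \<open>Linear functionals below sublinear ones\<close>

text \<open>
  Homogeneity is required as an inequality, the only part that has to be checked for the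
  infima below; equality follows by scaling back.
\<close>

definition sublinear :: "('a::real_vector \<Rightarrow> real) \<Rightarrow> bool" where
  "sublinear q \<longleftrightarrow>
    (\<forall>x y. q (x + y) \<le> q x + q y) \<and> (\<forall>c x. c > 0 \<longrightarrow> q (c *\<^sub>R x) \<le> c * q x)"

lemma sublinear_add: "sublinear q \<Longrightarrow> q (x + y) \<le> q x + q y"
  and sublinear_scale_le: "sublinear q \<Longrightarrow> c > 0 \<Longrightarrow> q (c *\<^sub>R x) \<le> c * q x"
  by (auto simp: sublinear_def)

lemma sublinear_scale:
  assumes "sublinear q" "c > 0"
  shows "q (c *\<^sub>R x) = c * q x"
proof (rule antisym)
  show "q (c *\<^sub>R x) \<le> c * q x"
    using assms by (rule sublinear_scale_le)
  have "q ((1 / c) *\<^sub>R c *\<^sub>R x) \<le> (1 / c) * q (c *\<^sub>R x)"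
    using assms by (intro sublinear_scale_le) auto
  then show "c * q x \<le> q (c *\<^sub>R x)"
    using assms(2) by (simp add: field_simps)
qed

lemma sublinear_zero:
  assumes "sublinear q"
  shows "q 0 = 0"
  using sublinear_scale[OF assms, of 2 0] by simp

lemma sublinear_minus:
  assumes "sublinear q"
  shows "- q (- x) \<le> q x"
  using sublinear_add[OF assms, of x "- x"] sublinear_zero[OF assms] by simp

text \<open>
  The lower bounds that Zorn's lemma asks for.  The values along the chain do not tend to
  \<open>-\<infinity>\<close>, since \<open>q x \<ge> - q (- x) \<ge> - p (- x)\<close>; subadditivity survives the infimum because any
  two members of the chain can be replaced by the smaller one.
\<close>

lemma sublinear_chain_inf:
  assumes "C \<noteq> {}" and sub: "\<And>q. q \<in> C \<Longrightarrow> sublinear q"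
    and below: "\<And>q x. q \<in> C \<Longrightarrow> q x \<le> p x"
    and chain: "\<And>q q'. q \<in> C \<Longrightarrow> q' \<in> C \<Longrightarrow> (\<forall>x. q x \<le> q' x) \<or> (\<forall>x. q' x \<le> q x)"
  shows "sublinear (\<lambda>x. INF q\<in>C. q x)" and "q \<in> C \<Longrightarrow> (INF q\<in>C. q x) \<le> q x"
proof -
  let ?u = "\<lambda>x. INF q\<in>C. q x"
  have "bdd_below ((\<lambda>q. q x) ` C)" for x
    using sublinear_minus[OF sub, of _ x] below[of _ "- x"]
    by (intro bdd_belowI2[where m = "- p (- x)"]) (smt (verit))
  then have lower: "?u x \<le> q x" if "q \<in> C" for q x
    using that by (intro cINF_lower) auto
  then show "q \<in> C \<Longrightarrow> ?u x \<le> q x" .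
  show "sublinear ?u"
    unfolding sublinear_def
  proof (intro conjI allI impI)
    fix x y
    have "?u (x + y) - q1 x \<le> q2 y" if q: "q1 \<in> C" "q2 \<in> C" for q1 q2
    proof -
      obtain q where "q \<in> C" "q x \<le> q1 x" "q y \<le> q2 y"
        using chain[OF q] q by fastforce
      then show ?thesis
        using lower[of q "x + y"] sublinear_add[OF sub, of q x y] by linarith
    qed
    then have "?u (x + y) - q1 x \<le> ?u y" if "q1 \<in> C" for q1
      using that \<open>C \<noteq> {}\<close> by (intro cINF_greatest) auto
    then have "?u (x + y) - ?u y \<le> ?u x"
      using \<open>C \<noteq> {}\<close> by (intro cINF_greatest) (auto simp: algebra_simps)
    then show "?u (x + y) \<le> ?u x + ?u y" by simp
  next
    fix c :: real and x assume "c > 0"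
    have "?u (c *\<^sub>R x) / c \<le> ?u x"
    proof (rule cINF_greatest)
      fix q assume "q \<in> C"
      then have "?u (c *\<^sub>R x) \<le> c * q x"
        using lower[of q "c *\<^sub>R x"] sublinear_scale[OF sub \<open>c > 0\<close>] by metis
      then show "?u (c *\<^sub>R x) / c \<le> q x"
        using \<open>c > 0\<close> by (simp add: field_simps)
    qed fact
    then show "?u (c *\<^sub>R x) \<le> c * ?u x"
      using \<open>c > 0\<close> by (simp add: field_simps)
  qed
qed

text \<open>
  Subtracting the value along the ray of \<open>x\<close> gives a sublinear functional below \<open>q\<close>
  whose value at \<open>y\<close> is at most \<open>q (y + x) - q x\<close>.  If \<open>q\<close> is minimal
  nothing changes, so \<open>q\<close> is superadditive as well.
\<close>

lemma sublinear_lowered_along_ray: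
  assumes "sublinear q"
  defines "r \<equiv> \<lambda>x y. INF t\<in>{0..}. q (y + t *\<^sub>R x) - t * q x"
  shows "sublinear (r x)" and "t \<ge> 0 \<Longrightarrow> r x y \<le> q (y + t *\<^sub>R x) - t * q x"
proof -
  have scale: "q (t *\<^sub>R x) = t * q x" if "t \<ge> 0" for t x
    using that sublinear_scale[OF assms(1)] sublinear_zero[OF assms(1)] by (cases "t = 0") auto
  have "- q (- y) \<le> q (y + t *\<^sub>R x) - t * q x" if "t \<ge> 0" for t x y
    using sublinear_add[OF assms(1), of "- y" "y + t *\<^sub>R x"] scale[OF that] by simp
  then have "bdd_below ((\<lambda>t. q (y + t *\<^sub>R x) - t * q x) ` {0..})" for x y
    by (intro bdd_belowI2[where m = "- q (- y)"]) auto
  then have lower: "r x y \<le> q (y + t *\<^sub>R x) - t * q x" if "t \<ge> 0" for t x y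
    unfolding r_def using that by (intro cINF_lower) auto
  then show "t \<ge> 0 \<Longrightarrow> r x y \<le> q (y + t *\<^sub>R x) - t * q x" .
  have r_eq: "r x y = (INF t\<in>{0..}. q (y + t *\<^sub>R x) - t * q x)" for x y
    by (simp add: r_def)
  show "sublinear (r x)"
    unfolding sublinear_def
  proof (intro conjI allI impI)
    fix y z
    have "r x (y + z) - (q (y + t *\<^sub>R x) - t * q x) \<le> q (z + s *\<^sub>R x) - s * q x"
      if "t \<ge> 0" "s \<ge> 0" for t s
      using lower[of "t + s" x "y + z"] that
        sublinear_add[OF assms(1), of "y + t *\<^sub>R x" "z + s *\<^sub>R x"]
      by (simp add: algebra_simps)
    then have "r x (y + z) - (q (y + t *\<^sub>R x) - t * q x) \<le> r x z" if "t \<ge> 0" for t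
      unfolding r_eq[of x z] using that
      by (intro cINF_greatest) auto
    then have "r x (y + z) - r x z \<le> r x y"
      unfolding r_eq[of x y] by (intro cINF_greatest) (auto simp: algebra_simps)
    then show "r x (y + z) \<le> r x y + r x z" by simp
  next
    fix c :: real and y assume "c > 0"
    have "r x (c *\<^sub>R y) / c \<le> r x y"
      unfolding r_eq[of x y]
    proof (rule cINF_greatest)
      fix t :: real assume "t \<in> {0..}"
      then have "r x (c *\<^sub>R y) \<le> q (c *\<^sub>R (y + t *\<^sub>R x)) - (c * t) * q x"
        using lower[of "c * t" x "c *\<^sub>R y"] \<open>c > 0\<close> by (simp add: algebra_simps)
      then show "r x (c *\<^sub>R y) / c \<le> q (y + t *\<^sub>R x) - t * q x"
        using \<open>c > 0\<close> scale[of c "y + t *\<^sub>R x"] by (simp add: field_simps)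
    qed auto
    then show "r x (c *\<^sub>R y) \<le> c * r x y"
      using \<open>c > 0\<close> by (simp add: field_simps)
  qed
qed

text \<open>
  The analytic form of the Hahn--Banach theorem.  Instead of extending a functional from
  subspaces, take a minimal sublinear functional below \<open>p\<close>: lowering it along any ray changes
  nothing, which makes it additive.
\<close>

proposition sublinear_dominates_linear:
  assumes "sublinear p"
  obtains l where "linear l" "\<And>x. l x \<le> p x"
proof -
  define A where "A = {q. sublinear q \<and> (\<forall>x. q x \<le> p x)}"
  define P :: "('a \<Rightarrow> real) \<Rightarrow> ('a \<Rightarrow> real) \<Rightarrow> bool" where "P = (\<lambda>q q'. \<forall>x. q' x \<le> q x)"
  have "\<exists>m\<in>A. \<forall>a\<in>A. P m a \<longrightarrow> a = m"
  proof (rule predicate_Zorn)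
    show "partial_order_on A (relation_of P A)"
      by (rule partial_order_on_relation_ofI)
        (auto simp: P_def intro: order_trans intro!: antisym le_funI)
    fix C assume "C \<in> Chains (relation_of P A)"
    then have C: "C \<subseteq> A" "\<And>q q'. q \<in> C \<Longrightarrow> q' \<in> C \<Longrightarrow> P q q' \<or> P q' q"
      by (auto simp: Chains_def relation_of_def)
    show "\<exists>u\<in>A. \<forall>a\<in>C. P a u"
    proof (cases "C = {}")
      case True
      then show ?thesis using assms by (auto simp: A_def)
    next
      case False
      have inf: "sublinear (\<lambda>x. INF q\<in>C. q x)" "\<And>q x. q \<in> C \<Longrightarrow> (INF q\<in>C. q x) \<le> q x"
        using sublinear_chain_inf[of C p] False C by (auto simp: A_def P_def subset_iff)
      then have "(INF q\<in>C. q x) \<le> p x" for x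
        using False C(1) by (force simp: A_def intro: order_trans)
      with inf show ?thesis
        by (intro bexI[of _ "\<lambda>x. INF q\<in>C. q x"]) (auto simp: A_def P_def)
    qed
  qed
  then obtain l where l: "sublinear l" "\<And>x. l x \<le> p x"
    and minimal: "\<And>q. sublinear q \<Longrightarrow> (\<And>x. q x \<le> l x) \<Longrightarrow> q = l"
    by (auto simp: A_def P_def intro: order_trans) (metis order_trans)
  have super: "l x + l y \<le> l (x + y)" for x y
  proof -
    let ?r = "\<lambda>y. INF t\<in>{0..}. l (y + t *\<^sub>R x) - t * l x"
    have "?r = l"
      using sublinear_lowered_along_ray(1)[OF l(1), where x = x]
        sublinear_lowered_along_ray(2)[OF l(1), where t = 0 and x = x]
      by (intro minimal) auto
    then have "?r y = l y" by (rule fun_cong)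
    then show ?thesis
      using sublinear_lowered_along_ray(2)[OF l(1), where t = 1 and x = x and y = y] by (simp add: add.commute)
  qed
  have add: "l (x + y) = l x + l y" for x y
    using super sublinear_add[OF l(1)] by (meson antisym)
  have neg: "l (- x) = - l x" for x
    using add[of x "- x"] sublinear_zero[OF l(1)] by simp
  have "l (c *\<^sub>R x) = c * l x" for c x
    using sublinear_scale[OF l(1), of c x] sublinear_scale[OF l(1), of "- c" "- x"]
      sublinear_zero[OF l(1)] neg[of x]
    by (cases c "0::real" rule: linorder_cases) auto
  with add have "linear l" by (intro linearI) auto
  then show thesis using l(2) by (rule that)
qed

section \<open>Subgradients of convex functions at interior points\<close>

text \<open>
  The point \<open>y + \<tau> *\<^sub>R (h + k)\<close> is a convex combination of \<open>y + t *\<^sub>R h\<close> and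
  \<open>y + s *\<^sub>R k\<close>; the step \<open>\<tau>\<close> is half the harmonic mean of \<open>t\<close> and \<open>s\<close>.  This is the
  subadditivity of the directional derivative.
\<close>

lemma convex_difference_quotient_add:
  assumes g: "convex_on S g" and t: "t > 0" "y + t *\<^sub>R h \<in> S" and s: "s > 0" "y + s *\<^sub>R k \<in> S"
  defines "\<tau> \<equiv> t * s / (t + s)"
  shows "\<tau> > 0" "y + \<tau> *\<^sub>R (h + k) \<in> S"
    and "(g (y + \<tau> *\<^sub>R (h + k)) - g y) / \<tau>
      \<le> (g (y + t *\<^sub>R h) - g y) / t + (g (y + s *\<^sub>R k) - g y) / s"
proof -
  have pos: "t + s > 0" using t s by simp
  show \<tau>: "\<tau> > 0" using t s by (simp add: \<tau>_def)
  have co: "s / (t + s) \<ge> 0" "t / (t + s) \<ge> 0" "s / (t + s) + t / (t + s) = 1"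
    using t s pos by (auto simp flip: add_divide_distrib)
  have "(s / (t + s)) *\<^sub>R y + (t / (t + s)) *\<^sub>R y = y"
    by (simp only: co(3) scaleR_one flip: scaleR_left_distrib)
  moreover have "(s / (t + s)) *\<^sub>R (y + t *\<^sub>R h) + (t / (t + s)) *\<^sub>R (y + s *\<^sub>R k) 
      = ((s / (t + s)) *\<^sub>R y + (t / (t + s)) *\<^sub>R y) + \<tau> *\<^sub>R (h + k)"
    by (simp add: \<tau>_def algebra_simps)
  ultimately have eq: "(s / (t + s)) *\<^sub>R (y + t *\<^sub>R h) + (t / (t + s)) *\<^sub>R (y + s *\<^sub>R k) = y + \<tau> *\<^sub>R (h + k)"
    by simp
  show "y + \<tau> *\<^sub>R (h + k) \<in> S"
    using convexD[OF convex_on_imp_convex[OF g] t(2) s(2) co] eq by simp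
  have "g (y + \<tau> *\<^sub>R (h + k)) \<le> s / (t + s) * g (y + t *\<^sub>R h) + t / (t + s) * g (y + s *\<^sub>R k)"
    using g t s co unfolding convex_on_def eq[symmetric] by blast
  also have "\<dots> - g y = \<tau> * ((g (y + t *\<^sub>R h) - g y) / t + (g (y + s *\<^sub>R k) - g y) / s)"
    using t s pos by (simp add: \<tau>_def divide_simps) (simp add: algebra_simps)
  finally show "(g (y + \<tau> *\<^sub>R (h + k)) - g y) / \<tau>
      \<le> (g (y + t *\<^sub>R h) - g y) / t + (g (y + s *\<^sub>R k) - g y) / s"
    using \<tau> by (simp add: divide_le_eq mult.commute)
qed

text \<open>
  The directional derivative of \<open>g\<close> at \<open>y\<close>, written as the infimum of the difference quotients,
  is sublinear, so it dominates a linear functional.  The upper bound on \<open>g\<close> near \<open>y\<close> bounds the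
  derivative by a multiple of the norm and thereby makes the functional continuous.
\<close>

proposition convex_bounded_has_subgradient:
  fixes g :: "'a::real_normed_vector \<Rightarrow> real"
  assumes g: "convex_on S g" and r: "r > 0" "ball y r \<subseteq> S"
    and M: "\<forall>w\<in>ball y r. g w \<le> M"
  shows "\<exists>\<zeta> :: 'a \<Rightarrow>\<^sub>L real. \<forall>w\<in>S. g y + blinfun_apply \<zeta> (w - y) \<le> g w"
proof -
  define T where "T h = {t. t > 0 \<and> y + t *\<^sub>R h \<in> S}" for h
  define D where "D h t = (g (y + t *\<^sub>R h) - g y) / t" for h t
  define p where "p h = (INF t\<in>T h. D h t)" for h
  have near: "r / (2 * norm h) > 0" "y + (r / (2 * norm h)) *\<^sub>R h \<in> ball y r" if "h \<noteq> 0" for h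
    using that r(1) by (auto simp: dist_norm)
  have T_ne: "T h \<noteq> {}" for h
  proof (cases "h = 0")
    case True
    then show ?thesis using r by (auto simp: T_def intro!: exI[of _ "1::real"])
  next
    case False
    then show ?thesis using near[of h] r(2) by (auto simp: T_def)
  qed
  have D_add: "\<exists>\<tau>\<in>T (h + k). D (h + k) \<tau> \<le> D h t + D k s" if "t \<in> T h" "s \<in> T k" for h k t s
    using convex_difference_quotient_add[OF g, of t y h s k] that
    by (intro bexI[of _ "t * s / (t + s)"]) (auto simp: T_def D_def)
  \<comment> \<open>the quotients in direction \<open>h\<close> are bounded below by minus any quotient in direction \<open>- h\<close>\<close>
  have "bdd_below (D h ` T h)" for h
  proof -
    obtain s where s: "s \<in> T (- h)" using T_ne by blast
    have "- D (- h) s \<le> D h t" if "t \<in> T h" for t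
      using D_add[OF that s] by (auto simp: D_def T_def)
    then show ?thesis by (intro bdd_belowI2) auto
  qed
  then have p_le: "p h \<le> D h t" if "t \<in> T h" for h t
    unfolding p_def using that by (intro cINF_lower) auto
  have "sublinear p"
    unfolding sublinear_def
  proof (intro conjI allI impI)
    fix h k
    have "p (h + k) - D h t \<le> D k s" if "t \<in> T h" "s \<in> T k" for t s
      using D_add[OF that] p_le[of _ "h + k"] by force
    then have "p (h + k) - D h t \<le> p k" if "t \<in> T h" for t
      unfolding p_def[of k] using that T_ne by (intro cINF_greatest) auto
    then have "p (h + k) - p k \<le> p h"
      unfolding p_def[of h] using T_ne by (intro cINF_greatest) (auto simp: algebra_simps)
    then show "p (h + k) \<le> p h + p k" by simp
  next
    fix c :: real and h assume c: "c > 0"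
    have "p (c *\<^sub>R h) / c \<le> p h"
      unfolding p_def[of h]
    proof (rule cINF_greatest[OF T_ne])
      fix t assume "t \<in> T h"
      then have "t / c \<in> T (c *\<^sub>R h)" and "D (c *\<^sub>R h) (t / c) = c * D h t"
        using c by (auto simp: T_def D_def)
      then have "p (c *\<^sub>R h) \<le> c * D h t" using p_le by metis
      then show "p (c *\<^sub>R h) / c \<le> D h t" using c by (simp add: field_simps)
    qed
    then show "p (c *\<^sub>R h) \<le> c * p h" using c by (simp add: field_simps)
  qed
  then obtain l where l: "linear l" "\<And>h. l h \<le> p h"
    using sublinear_dominates_linear by blast
  define C where "C = 2 * (M - g y) / r"
  have bound: "l h \<le> norm h * C" for h
  proof (cases "h = 0")
    case True
    then show ?thesis using linear_0[OF l(1)] by simp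
  next
    case False
    then have "l h \<le> D h (r / (2 * norm h))"
      using l(2)[of h] p_le[of "r / (2 * norm h)" h] near[of h] r(2)
      by (auto simp: T_def subset_iff intro: order_trans)
    also have "\<dots> \<le> (M - g y) / (r / (2 * norm h))"
      unfolding D_def using bspec[OF M near(2)[OF False]] near(1)[OF False]
      by (intro divide_right_mono) auto
    finally show ?thesis by (simp add: C_def field_simps)
  qed
  have "\<bar>l h\<bar> \<le> norm h * C" for h
    using bound[of h] bound[of "- h"] linear_neg[OF l(1), of h] by simp
  then have "bounded_linear l"
    using l(1) by (intro bounded_linear_intro[where K = C]) (auto simp: linear_add linear_scale)
  then have apply_l: "blinfun_apply (Blinfun l) = l"
    by (rule bounded_linear_Blinfun_apply)
  have "g y + l (w - y) \<le> g w" if "w \<in> S" for w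
    using l(2)[of "w - y"] p_le[of 1 "w - y"] that by (simp add: T_def D_def)
  then show ?thesis
    by (intro exI[of _ "Blinfun l"]) (simp add: apply_l)
qed

text \<open>
  The segment from \<open>x\<close> to \<open>c\<close> carries a neighbourhood of \<open>c\<close> to one of the intermediate point.
\<close>

lemma interior_convex_shrink:
  fixes S :: "'a::real_normed_vector set"
  assumes "convex S" "c \<in> interior S" "x \<in> S" and t: "0 < t" "t \<le> 1"
  shows "x + t *\<^sub>R (c - x) \<in> interior S"
proof -
  let ?h = "\<lambda>w. (1 - t) *\<^sub>R x + t *\<^sub>R w"
  have "open ((\<lambda>w. (1 - t) *\<^sub>R x + w) ` (\<lambda>w. t *\<^sub>R w) ` interior S)"
    using t by (intro open_translation open_scaling) auto
  then have "open (?h ` interior S)" by (simp add: image_image)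
  moreover have "?h ` interior S \<subseteq> S"
    using t interior_subset[of S] assms(1,3) by (auto intro!: convexD)
  ultimately have "?h ` interior S \<subseteq> interior S" by (rule interior_maximal[rotated])
  moreover have "x + t *\<^sub>R (c - x) = ?h c" by (simp add: algebra_simps)
  ultimately show ?thesis using assms(2) by (simp add: image_subset_iff)
qed

text \<open>
  Local boundedness spreads from one point \<open>a\<close> to every interior point \<open>y\<close>: a small ball around
  \<open>y\<close> consists of convex combinations of a fixed point of \<open>S\<close> beyond \<open>y\<close> and of points near
  \<open>a\<close>.
\<close>

lemma convex_bounded_above_near_interior_point:
  fixes g :: "'a::real_normed_vector \<Rightarrow> real"
  assumes g: "convex_on S g" and r: "r > 0" "ball a r \<subseteq> S" "\<forall>w\<in>ball a r. g w \<le> M"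
    and y: "y \<in> interior S"
  obtains \<rho> K where "\<rho> > 0" "ball y \<rho> \<subseteq> S" "\<forall>w\<in>ball y \<rho>. g w \<le> K"
proof -
  \<comment> \<open>extend the segment from \<open>a\<close> to \<open>y\<close> a little beyond \<open>y\<close>, to the point \<open>b\<close>\<close>
  have "((\<lambda>s. y + s *\<^sub>R (y - a)) \<longlongrightarrow> y + 0 *\<^sub>R (y - a)) (at_right 0)"
    by (intro tendsto_intros)
  then have "\<forall>\<^sub>F s in at_right 0. y + s *\<^sub>R (y - a) \<in> interior S"
    using y by (auto elim!: topological_tendstoD[OF _ open_interior])
  moreover have "\<forall>\<^sub>F s in at_right 0. s > (0::real)"
    by (simp add: eventually_at_right_less)
  ultimately have "\<forall>\<^sub>F s in at_right 0. s > (0::real) \<and> y + s *\<^sub>R (y - a) \<in> interior S"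
    by (rule eventually_conj[rotated])
  then obtain s where s: "s > 0" "y + s *\<^sub>R (y - a) \<in> interior S"
    using eventually_happens[of _ "at_right (0::real)"] by (auto simp: trivial_limit_at_right_real)
  define b where "b = y + s *\<^sub>R (y - a)"
  have "b \<in> S" using s(2) interior_subset by (auto simp: b_def)
  define \<rho> where "\<rho> = s / (1 + s) * r"
  have "\<rho> > 0" using s(1) r(1) by (simp add: \<rho>_def)
  have split: "w \<in> S \<and> g w \<le> \<bar>g b\<bar> + \<bar>M\<bar>" if "w \<in> ball y \<rho>" for w
  proof -
    define v where "v = a + ((1 + s) / s) *\<^sub>R (w - y)"
    have v: "v \<in> ball a r"
    proof -
      have "norm (w - y) < s / (1 + s) * r"
        using that by (simp add: \<rho>_def dist_norm norm_minus_commute)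
      then have "((1 + s) / s) * norm (w - y) < r"
        using s(1) by (simp add: field_simps)
      then show ?thesis using s(1) by (simp add: v_def dist_norm)
    qed
    have co: "1 / (1 + s) \<ge> 0" "s / (1 + s) \<ge> 0" "1 / (1 + s) + s / (1 + s) = 1"
      using s(1) by (auto simp flip: add_divide_distrib)
    have "s *\<^sub>R v = s *\<^sub>R a + (1 + s) *\<^sub>R (w - y)"
      using s(1) by (simp add: v_def scaleR_add_right)
    then have "(1 + s) *\<^sub>R w = b + s *\<^sub>R v"
      by (simp add: b_def algebra_simps)
    then have "(1 / (1 + s)) *\<^sub>R (1 + s) *\<^sub>R w = (1 / (1 + s)) *\<^sub>R (b + s *\<^sub>R v)" by simp
    then have w: "w = (1 / (1 + s)) *\<^sub>R b + (s / (1 + s)) *\<^sub>R v"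
      using s(1) by (simp add: scaleR_add_right)
    have "g w \<le> 1 / (1 + s) * g b + s / (1 + s) * g v"
      using g \<open>b \<in> S\<close> v r(2) co unfolding convex_on_def w by blast
    also have "\<dots> \<le> 1 * \<bar>g b\<bar> + 1 * \<bar>M\<bar>"
    proof (rule add_mono)
      show "1 / (1 + s) * g b \<le> 1 * \<bar>g b\<bar>"
        using s(1) by (simp add: field_simps) (smt (verit) mult_nonneg_nonneg abs_ge_zero)
      have "s / (1 + s) * g v \<le> s / (1 + s) * \<bar>M\<bar>"
        using bspec[OF r(3) v] co by (intro mult_left_mono) auto
      also have "\<dots> \<le> 1 * \<bar>M\<bar>"
        using s(1) by (intro mult_right_mono) (auto simp: field_simps)
      finally show "s / (1 + s) * g v \<le> 1 * \<bar>M\<bar>" .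
    qed
    finally have "g w \<le> \<bar>g b\<bar> + \<bar>M\<bar>" by simp
    moreover have "w \<in> S"
      using convexD[OF convex_on_imp_convex[OF g] \<open>b \<in> S\<close> _ co, of v] v r(2) w by auto
    ultimately show ?thesis by simp
  qed
  show thesis
    using split by (intro that[OF \<open>\<rho> > 0\<close>, of "\<bar>g b\<bar> + \<bar>M\<bar>"]) auto
qed

text \<open>
  Completeness enters here, through Baire's theorem: one of the countably many closed sets
  \<open>{w \<in> S. g w \<le> n}\<close> must have an interior point.
\<close>

lemma closed_sublevels_bounded_on_ball:
  fixes g :: "'a::banach \<Rightarrow> real"
  assumes cl: "\<And>c. closed {w \<in> S. g w \<le> c}" and ne: "interior S \<noteq> {}"
  obtains r a M where "r > 0" "ball a r \<subseteq> S" "\<forall>w\<in>ball a r. g w \<le> M"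
proof -
  let ?\<G> = "range (\<lambda>n::nat. {w \<in> S. g w \<le> real n})"
  have "\<exists>T\<in>?\<G>. interior T \<noteq> {}"
  proof (rule ccontr)
    assume "\<not> ?thesis"
    then have "euclidean interior_of \<Union>?\<G> = {}"
      using cl by (intro Baire_category_alt disjI1 completely_metrizable_space_euclidean) auto
    moreover have "\<Union>?\<G> = S"
      using real_arch_simple by fastforce
    ultimately show False using ne by simp
  qed
  then obtain n a where "a \<in> interior {w \<in> S. g w \<le> real n}" by blast
  then obtain r where "r > 0" "ball a r \<subseteq> {w \<in> S. g w \<le> real n}"
    by (auto simp: mem_interior)
  then show thesis by (intro that[of r a "real n"]) auto
qed

proposition convex_lsc_has_subgradient:
  fixes g :: "'a::banach \<Rightarrow> real"
  assumes g: "convex_on S g" and cl: "\<And>c. closed {w \<in> S. g w \<le> c}" and y: "y \<in> interior S"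
  shows "\<exists>\<zeta> :: 'a \<Rightarrow>\<^sub>L real. \<forall>w\<in>S. g y + blinfun_apply \<zeta> (w - y) \<le> g w"
proof -
  have ne: "interior S \<noteq> {}" using y by blast
  obtain r a M where *: "r > 0" "ball a r \<subseteq> S" "\<forall>w\<in>ball a r. g w \<le> M"
    by (rule closed_sublevels_bounded_on_ball[OF cl ne])
  obtain \<rho> K where **: "\<rho> > 0" "ball y \<rho> \<subseteq> S" "\<forall>w\<in>ball y \<rho>. g w \<le> K"
    by (rule convex_bounded_above_near_interior_point[OF g * y])
  show ?thesis
    by (rule convex_bounded_has_subgradient[OF g **])
qed

section \<open>Separation and weak compactness in reflexive spaces\<close>

lemma convex_on_infdist:
  fixes K :: "'a::real_normed_vector set"
  assumes "convex K" "K \<noteq> {}"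
  shows "convex_on UNIV (\<lambda>x. infdist x K)"
proof
  fix t :: real and x y :: 'a assume t: "0 < t" "t < 1"
  let ?m = "(1 - t) *\<^sub>R x + t *\<^sub>R y"
  have *: "infdist ?m K \<le> (1 - t) * dist x a + t * dist y b" if "a \<in> K" "b \<in> K" for a b
  proof -
    have "(1 - t) *\<^sub>R a + t *\<^sub>R b \<in> K"
      using assms(1) that t by (intro convexD) auto
    then have "infdist ?m K \<le> norm (?m - ((1 - t) *\<^sub>R a + t *\<^sub>R b))"
      by (metis dist_norm infdist_le)
    also have "?m - ((1 - t) *\<^sub>R a + t *\<^sub>R b) = (1 - t) *\<^sub>R (x - a) + t *\<^sub>R (y - b)"
      by (simp add: algebra_simps)
    also have "norm \<dots> \<le> (1 - t) * dist x a + t * dist y b"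
      using norm_triangle_ineq[of "(1 - t) *\<^sub>R (x - a)" "t *\<^sub>R (y - b)"] t
      by (simp add: dist_norm)
    finally show ?thesis .
  qed
  have "(infdist ?m K - t * dist y b) / (1 - t) \<le> infdist x K" if "b \<in> K" for b
    unfolding infdist_notempty[OF assms(2)]
    using * that assms(2) t
    by (intro cINF_greatest) (auto simp: divide_le_eq infdist_notempty algebra_simps)
  then have "(infdist ?m K - (1 - t) * infdist x K) / t \<le> dist y b" if "b \<in> K" for b
    using that t by (simp add: divide_le_eq algebra_simps)
  then have "(infdist ?m K - (1 - t) * infdist x K) / t \<le> infdist y K"
    unfolding infdist_notempty[OF assms(2), of y] using assms(2) by (intro cINF_greatest) auto
  then show "infdist ?m K \<le> (1 - t) * infdist x K + t * infdist y K"
    using t by (simp add: divide_le_eq algebra_simps)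
qed simp

text \<open>
  A subgradient at \<open>z\<close> of the distance to \<open>K\<close> separates \<open>z\<close> from \<open>K\<close>, with the distance
  itself as the gap.
\<close>

proposition closed_convex_strict_separation:
  fixes K :: "'a::real_normed_vector set"
  assumes "closed K" "convex K" "K \<noteq> {}" "z \<notin> K"
  obtains \<zeta> :: "'a \<Rightarrow>\<^sub>L real" and \<delta> where "\<delta> > 0"
    "\<forall>w\<in>K. blinfun_apply \<zeta> w \<le> blinfun_apply \<zeta> z - \<delta>"
proof -
  have pos: "infdist z K > 0"
    using assms infdist_pos_not_in_closed by metis
  have near: "\<forall>w\<in>ball z 1. infdist w K \<le> infdist z K + 1"
  proof
    fix w assume "w \<in> ball z 1"
    then show "infdist w K \<le> infdist z K + 1"
      using infdist_triangle[of w K z] by (simp add: dist_commute)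
  qed
  obtain \<zeta> :: "'a \<Rightarrow>\<^sub>L real"
    where \<zeta>: "\<forall>w\<in>UNIV. infdist z K + blinfun_apply \<zeta> (w - z) \<le> infdist w K"
    using convex_bounded_has_subgradient[OF convex_on_infdist[OF assms(2,3)] _ _ near] by auto
  have "\<forall>w\<in>K. blinfun_apply \<zeta> w \<le> blinfun_apply \<zeta> z - infdist z K"
  proof
    fix w assume "w \<in> K"
    then show "blinfun_apply \<zeta> w \<le> blinfun_apply \<zeta> z - infdist z K"
      using bspec[OF \<zeta>, of w] by (simp add: blinfun.diff_right)
  qed
  with pos show thesis by (rule that)
qed

text \<open>
  Weak compactness in the form of a finite intersection property.  Regard points as functions on
  the dual.  By Tychonoff's theorem, the closures of the sets of evaluations have a common point
  \<open>\<phi>\<close> in the product topology.  It is linear and bounded, as a limit of evaluations from the bounded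
  set \<open>K0\<close>, so reflexivity represents it by a point \<open>z\<close>.  A functional that separates \<open>z\<close> from some
  \<open>K\<close> would contradict that \<open>\<phi>\<close> is a limit of evaluations from \<open>K\<close>.
\<close>

proposition reflexive_bounded_closed_convex_fip:
  fixes \<K> :: "'a::real_normed_vector set set"
  assumes refl: "reflexive_space TYPE('a)"
    and \<K>: "\<And>K. K \<in> \<K> \<Longrightarrow> closed K \<and> convex K"
    and K0: "K0 \<in> \<K>" "bounded K0"
    and fip: "\<And>\<F>. finite \<F> \<Longrightarrow> \<F> \<subseteq> \<K> \<Longrightarrow> K0 \<inter> \<Inter>\<F> \<noteq> {}"
  shows "\<Inter>\<K> \<noteq> {}"
proof -
  define ev :: "'a \<Rightarrow> ('a \<Rightarrow>\<^sub>L real) \<Rightarrow> real" where "ev z = (\<lambda>\<zeta>. blinfun_apply \<zeta> z)" for z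
  obtain R where R: "\<And>z. z \<in> K0 \<Longrightarrow> norm z \<le> R"
    using K0(2) by (auto simp: bounded_iff)
  define B where "B = PiE UNIV (\<lambda>\<zeta>::'a \<Rightarrow>\<^sub>L real. {- (norm \<zeta> * R)..norm \<zeta> * R})"
  have "compactin (product_topology (\<lambda>_::'a \<Rightarrow>\<^sub>L real. euclideanreal) UNIV) B"
    unfolding B_def by (subst compactin_PiE) auto
  then have "compact B" by (simp add: euclidean_product_topology)
  have ev_B: "ev z \<in> B" if "z \<in> K0" for z
  proof -
    have "\<bar>blinfun_apply \<zeta> z\<bar> \<le> norm \<zeta> * R" for \<zeta> :: "'a \<Rightarrow>\<^sub>L real"
      using norm_blinfun[of \<zeta> z] mult_left_mono[OF R[OF that], of "norm \<zeta>"] by simp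
    then show ?thesis by (auto simp: B_def ev_def abs_le_iff minus_le_iff)
  qed
  have "B \<inter> \<Inter>((\<lambda>K. closure (ev ` (K \<inter> K0))) ` \<K>) \<noteq> {}"
  proof (rule compact_imp_fip_image[OF \<open>compact B\<close>])
    fix \<F> assume "finite \<F>" "\<F> \<subseteq> \<K>"
    then obtain z where "z \<in> K0" "\<And>K. K \<in> \<F> \<Longrightarrow> z \<in> K" using fip[of \<F>] by blast
    then have "ev z \<in> B \<inter> \<Inter>((\<lambda>K. closure (ev ` (K \<inter> K0))) ` \<F>)"
      using ev_B closure_subset by fastforce
    then show "B \<inter> \<Inter>((\<lambda>K. closure (ev ` (K \<inter> K0))) ` \<F>) \<noteq> {}" by blast
  qed auto
  then obtain \<phi> where \<phi>: "\<phi> \<in> B" "\<And>K. K \<in> \<K> \<Longrightarrow> \<phi> \<in> closure (ev ` (K \<inter> K0))" by blast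
  have coord: "continuous_on UNIV (\<lambda>\<phi>. \<phi> \<zeta>)" for \<zeta> :: "'a \<Rightarrow>\<^sub>L real"
    by (rule continuous_on_product_coordinates)
  have limit: "P \<phi>" if "K \<in> \<K>" "closed {\<psi>. P \<psi>}" "\<And>z. z \<in> K \<Longrightarrow> P (ev z)" for K P
    using closure_minimal[of "ev ` (K \<inter> K0)" "{\<psi>. P \<psi>}"] that \<phi>(2) by blast
  have "\<phi> (\<zeta> + \<xi>) = \<phi> \<zeta> + \<phi> \<xi>" for \<zeta> \<xi>
    by (rule limit[OF K0(1), of "\<lambda>\<psi>. \<psi> (\<zeta> + \<xi>) = \<psi> \<zeta> + \<psi> \<xi>"])
      (intro closed_Collect_eq continuous_on_add coord, simp add: ev_def blinfun.add_left)
  moreover have "\<phi> (c *\<^sub>R \<zeta>) = c * \<phi> \<zeta>" for c \<zeta>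
    by (rule limit[OF K0(1), of "\<lambda>\<psi>. \<psi> (c *\<^sub>R \<zeta>) = c * \<psi> \<zeta>"])
      (intro closed_Collect_eq continuous_on_mult continuous_on_const coord,
        simp add: ev_def blinfun.scaleR_left)
  moreover have "\<bar>\<phi> \<zeta>\<bar> \<le> norm \<zeta> * R" for \<zeta>
    using \<phi>(1) by (auto simp: B_def PiE_iff abs_le_iff minus_le_iff)
  ultimately have "bounded_linear \<phi>"
    by (intro bounded_linear_intro[where K = R]) auto
  then have "\<phi> = blinfun_apply (Blinfun \<phi>)"
    by (simp add: bounded_linear_Blinfun_apply)
  then obtain z where z: "\<And>\<zeta>. \<phi> \<zeta> = blinfun_apply \<zeta> z"
    using refl unfolding reflexive_space_def by metis
  have "z \<in> K" if K: "K \<in> \<K>" for K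
  proof (rule ccontr)
    assume "z \<notin> K"
    moreover have "K \<noteq> {}" using fip[of "{K}"] K by auto
    ultimately obtain \<zeta> :: "'a \<Rightarrow>\<^sub>L real" and \<delta> where \<zeta>: "\<delta> > 0"
      "\<forall>w\<in>K. blinfun_apply \<zeta> w \<le> blinfun_apply \<zeta> z - \<delta>"
      using closed_convex_strict_separation[of K z] \<K>[OF K] by metis
    have "\<phi> \<zeta> \<le> blinfun_apply \<zeta> z - \<delta>"
      by (rule limit[OF K, of "\<lambda>\<psi>. \<psi> \<zeta> \<le> blinfun_apply \<zeta> z - \<delta>"])
        (intro closed_Collect_le continuous_on_const coord, simp add: ev_def \<zeta>(2))
    with z \<zeta>(1) show False by simp
  qed
  then show ?thesis by blast
qed

section \<open>Finite families of concave functions and strongly monotone sets\<close>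

text \<open>
  Moving from \<open>a\<close> towards \<open>b\<close>, the square of the positive part grows no faster than if \<open>a\<close> were
  replaced by its positive part.
\<close>

lemma max_zero_power2_le:
  fixes a b t :: real
  assumes "0 \<le> t" "t \<le> 1"
  shows "(max 0 ((1 - t) * a + t * b))\<^sup>2 \<le> ((1 - t) * max 0 a + t * b)\<^sup>2"
proof (cases "(1 - t) * a + t * b \<le> 0")
  case False
  have "(1 - t) * a \<le> (1 - t) * max 0 a"
    using assms by (intro mult_left_mono) auto
  then show ?thesis using False by (intro power_mono) auto
qed auto

text \<open>
  If the functions are affine this is the statement that a matrix game whose matrix plus its
  transpose is nonnegative has nonnegative value.  A minimiser \<open>z\<close> of the sum of the squared negative
  parts \<open>r i\<close> does the job: otherwise move from \<open>z\<close> towards the mean \<open>\<nu>\<close> of the points \<open>y i\<close>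
  with weights proportional to \<open>r i\<close>.  By concavity and the symmetry condition,
  \<open>(\<Sum>i\<in>I. r i * \<psi> i \<nu>) \<ge> 0\<close>, and therefore this move lowers the sum to first order.
\<close>

proposition concave_family_common_nonneg_point:
  fixes y :: "'i \<Rightarrow> 'a::real_normed_vector" and \<psi> :: "'i \<Rightarrow> 'a \<Rightarrow> real"
  assumes I: "finite I" "I \<noteq> {}"
    and concave: "\<And>i. i \<in> I \<Longrightarrow> concave_on (convex hull (y ` I)) (\<psi> i)"
    and cont: "\<And>i. i \<in> I \<Longrightarrow> continuous_on (convex hull (y ` I)) (\<psi> i)"
    and sym: "\<And>i k. i \<in> I \<Longrightarrow> k \<in> I \<Longrightarrow> \<psi> i (y k) + \<psi> k (y i) \<ge> 0"
  obtains z where "z \<in> convex hull (y ` I)" "\<forall>i\<in>I. \<psi> i z \<ge> 0"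
proof -
  let ?C = "convex hull (y ` I)"
  define \<Phi> where "\<Phi> z = (\<Sum>i\<in>I. (max 0 (- \<psi> i z))\<^sup>2)" for z
  have "compact ?C" using I by (intro finite_imp_compact_convex_hull) auto
  moreover have "?C \<noteq> {}" using I by simp
  moreover have "continuous_on ?C \<Phi>"
    unfolding \<Phi>_def using cont by (intro continuous_intros) auto
  ultimately obtain z where z: "z \<in> ?C" "\<And>w. w \<in> ?C \<Longrightarrow> \<Phi> z \<le> \<Phi> w"
    using continuous_attains_inf[of ?C \<Phi>] by blast
  define r where "r i = max 0 (- \<psi> i z)" for i
  define R where "R = sum r I"
  have r_nn: "r i \<ge> 0" for i by (simp add: r_def)
  have "r i = 0" if "i \<in> I" for i
  proof (rule ccontr)
    assume "r i \<noteq> 0"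
    then have "r i > 0" using r_nn[of i] by simp
    then have "R > 0"
      unfolding R_def using that I r_nn by (intro sum_pos2[of I i]) auto
    have Phi_pos: "\<Phi> z > 0"
      unfolding \<Phi>_def r_def[symmetric] using that I \<open>r i > 0\<close> by (intro sum_pos2[of I i]) auto
    define \<nu> where "\<nu> = (\<Sum>k\<in>I. (r k / R) *\<^sub>R y k)"
    define b where "b j = - \<psi> j \<nu>" for j
    have weights: "(\<Sum>k\<in>I. r k / R) = 1" "\<And>k. r k / R \<ge> 0"
      using \<open>R > 0\<close> r_nn by (auto simp: R_def simp flip: sum_divide_distrib)
    have vertex: "y k \<in> ?C" if "k \<in> I" for k
      using that by (simp add: hull_inc)
    have \<nu>: "\<nu> \<in> ?C"
      unfolding \<nu>_def using weights I vertex by (intro convex_sum) auto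
    have jensen: "(\<Sum>k\<in>I. r k / R * \<psi> j (y k)) \<le> \<psi> j \<nu>" if "j \<in> I" for j
      unfolding \<nu>_def using weights I vertex by (intro concave_on_sum[OF _ _ concave[OF that]]) auto
    have "(\<Sum>j\<in>I. \<Sum>k\<in>I. r j * r k * \<psi> j (y k)) = (\<Sum>j\<in>I. \<Sum>k\<in>I. r j * r k * \<psi> k (y j))"
      by (subst sum.swap) (simp add: mult.commute)
    then have "2 * (\<Sum>j\<in>I. \<Sum>k\<in>I. r j * r k * \<psi> j (y k))
        = (\<Sum>j\<in>I. \<Sum>k\<in>I. r j * r k * (\<psi> j (y k) + \<psi> k (y j)))"
      by (simp add: distrib_left sum.distrib)
    also have "\<dots> \<ge> 0"
      using sym r_nn by (intro sum_nonneg mult_nonneg_nonneg) auto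
    finally have "0 \<le> (\<Sum>j\<in>I. \<Sum>k\<in>I. r j * r k * \<psi> j (y k)) / R"
      using \<open>R > 0\<close> by simp
    also have "\<dots> = (\<Sum>j\<in>I. r j * (\<Sum>k\<in>I. r k / R * \<psi> j (y k)))"
      by (simp add: sum_divide_distrib sum_distrib_left mult.assoc)
    also have "\<dots> \<le> (\<Sum>j\<in>I. r j * \<psi> j \<nu>)"
      using jensen r_nn by (intro sum_mono mult_left_mono) auto
    finally have cross: "(\<Sum>j\<in>I. r j * b j) \<le> 0"
      by (simp add: b_def sum_negf)
    define B where "B = (\<Sum>j\<in>I. (b j)\<^sup>2)"
    have Phi_eq: "\<Phi> z = (\<Sum>j\<in>I. (r j)\<^sup>2)" by (simp add: \<Phi>_def r_def)
    \<comment> \<open>compare \<open>z\<close> with the point at parameter \<open>t\<close> on the segment to \<open>\<nu>\<close>\<close>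
    have descent: "2 * \<Phi> z \<le> t * (\<Phi> z + B)" if t: "0 < t" "t \<le> 1" for t
    proof -
      have "\<Phi> z \<le> \<Phi> ((1 - t) *\<^sub>R z + t *\<^sub>R \<nu>)"
        using t z(1) \<nu> by (intro z(2) convexD[OF convex_convex_hull]) auto
      also have "\<dots> \<le> (\<Sum>j\<in>I. ((1 - t) * r j + t * b j)\<^sup>2)"
        unfolding \<Phi>_def
      proof (rule sum_mono)
        fix j assume "j \<in> I"
        have "- \<psi> j ((1 - t) *\<^sub>R z + t *\<^sub>R \<nu>) \<le> (1 - t) * (- \<psi> j z) + t * b j"
          using concave_onD[OF concave[OF \<open>j \<in> I\<close>], of t z \<nu>] t z(1) \<nu> by (simp add: b_def)
        then have "(max 0 (- \<psi> j ((1 - t) *\<^sub>R z + t *\<^sub>R \<nu>)))\<^sup>2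
            \<le> (max 0 ((1 - t) * (- \<psi> j z) + t * b j))\<^sup>2"
          by (intro power_mono) auto
        also have "\<dots> \<le> ((1 - t) * r j + t * b j)\<^sup>2"
          unfolding r_def using t by (intro max_zero_power2_le) auto
        finally show "(max 0 (- \<psi> j ((1 - t) *\<^sub>R z + t *\<^sub>R \<nu>)))\<^sup>2 \<le> ((1 - t) * r j + t * b j)\<^sup>2" .
      qed
      also have "\<dots> = (\<Sum>j\<in>I. (1 - t)\<^sup>2 * (r j)\<^sup>2 + 2 * t * (1 - t) * (r j * b j) + t\<^sup>2 * (b j)\<^sup>2)"
        by (intro sum.cong refl) (simp add: power2_eq_square algebra_simps)
      also have "\<dots> = (1 - t)\<^sup>2 * \<Phi> z + 2 * t * (1 - t) * (\<Sum>j\<in>I. r j * b j) + t\<^sup>2 * B"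
        by (simp add: Phi_eq B_def sum.distrib sum_distrib_left)
      also have "\<dots> \<le> (1 - t)\<^sup>2 * \<Phi> z + t\<^sup>2 * B"
        using cross t by (simp add: mult_nonneg_nonpos)
      finally have "t * (2 * \<Phi> z) \<le> t * (t * (\<Phi> z + B))"
        by (simp add: power2_eq_square algebra_simps)
      then show ?thesis using t by simp
    qed
    have "B \<ge> 0" by (simp add: B_def sum_nonneg)
    \<comment> \<open>the step for which \<open>descent\<close> gives \<open>2 * \<Phi> z \<le> \<Phi> z\<close>\<close>
    define t where "t = \<Phi> z / (\<Phi> z + B)"
    have "t > 0" "t \<le> 1" using Phi_pos \<open>B \<ge> 0\<close> by (auto simp: t_def)
    moreover have "t * (\<Phi> z + B) = \<Phi> z"
      using Phi_pos \<open>B \<ge> 0\<close> by (simp add: t_def)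
    ultimately show False using descent[of t] Phi_pos by linarith
  qed
  then have "\<forall>i\<in>I. \<psi> i z \<ge> 0"
    by (fastforce simp: r_def max_def split: if_splits)
  with z(1) show thesis by (rule that)
qed

lemma concave_on_linear_minus_dist_square:
  fixes q :: "'a::real_normed_vector \<Rightarrow>\<^sub>L real"
  assumes "c \<ge> 0" "convex S"
  shows "concave_on S (\<lambda>z. blinfun_apply q (y - z) - c * (norm (y - z))\<^sup>2)"
  unfolding concave_on_def
proof (rule convex_onI)
  fix t :: real and z w :: 'a assume t: "0 < t" "t < 1"
  define a b where "a = norm (y - z)" and "b = norm (y - w)"
  have eq: "y - ((1 - t) *\<^sub>R z + t *\<^sub>R w) = (1 - t) *\<^sub>R (y - z) + t *\<^sub>R (y - w)"
    by (simp add: algebra_simps)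
  have "norm ((1 - t) *\<^sub>R (y - z) + t *\<^sub>R (y - w)) \<le> (1 - t) * a + t * b"
    using norm_triangle_ineq[of "(1 - t) *\<^sub>R (y - z)" "t *\<^sub>R (y - w)"] t by (simp add: a_def b_def)
  then have "(norm ((1 - t) *\<^sub>R (y - z) + t *\<^sub>R (y - w)))\<^sup>2 \<le> ((1 - t) * a + t * b)\<^sup>2"
    by (intro power_mono) auto
  also have "\<dots> = (1 - t) * a\<^sup>2 + t * b\<^sup>2 - t * (1 - t) * (a - b)\<^sup>2"
    by (simp add: power2_eq_square algebra_simps)
  also have "\<dots> \<le> (1 - t) * a\<^sup>2 + t * b\<^sup>2"
    using t by simp
  finally have "c * (norm ((1 - t) *\<^sub>R (y - z) + t *\<^sub>R (y - w)))\<^sup>2 \<le> c * ((1 - t) * a\<^sup>2 + t * b\<^sup>2)"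
    using assms(1) by (intro mult_left_mono)
  then show "- (blinfun_apply q (y - ((1 - t) *\<^sub>R z + t *\<^sub>R w))
        - c * (norm (y - ((1 - t) *\<^sub>R z + t *\<^sub>R w)))\<^sup>2)
      \<le> (1 - t) * - (blinfun_apply q (y - z) - c * (norm (y - z))\<^sup>2)
        + t * - (blinfun_apply q (y - w) - c * (norm (y - w))\<^sup>2)"
    unfolding eq a_def b_def blinfun.add_right blinfun.scaleR_right
    by (simp add: algebra_simps)
qed fact

text \<open>
  Strong monotonicity is spent in two equal parts.  One half is put into the conditions on \<open>z\<close>, as
  \<open>blinfun_apply q (y - z) \<ge> \<theta> / 2 * (norm (y - z))\<^sup>2\<close>: each of them describes a closed convex set that
  is bounded even if \<open>X\<close> is not.  The other half pays for the symmetry condition that makes any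
  finitely many of these sets intersect within the convex hull of the base points, since
  \<open>\<psi> a (fst a') + \<psi> a' (fst a)\<close> contains the square of the distance twice with factor \<open>\<theta> / 2\<close>.
\<close>

proposition strongly_monotone_minty_point:
  fixes A :: "('a::real_normed_vector \<times> ('a \<Rightarrow>\<^sub>L real)) set"
  assumes refl: "reflexive_space TYPE('a)"
    and X: "closed X" "convex X" and A: "A \<noteq> {}" "fst ` A \<subseteq> X" and "\<theta> > 0"
    and mono: "\<And>y q y' q'. (y, q) \<in> A \<Longrightarrow> (y', q') \<in> A \<Longrightarrow>
      blinfun_apply (q - q') (y - y') \<ge> \<theta> * (norm (y - y'))\<^sup>2"
  obtains z where "z \<in> X" "\<forall>(y, q)\<in>A. blinfun_apply q (y - z) \<ge> 0"
proof -
  define \<psi> :: "'a \<times> ('a \<Rightarrow>\<^sub>L real) \<Rightarrow> 'a \<Rightarrow> real" where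
    "\<psi> = (\<lambda>(y, q) z. blinfun_apply q (y - z) - \<theta> / 2 * (norm (y - z))\<^sup>2)"
  define K where "K a = X \<inter> {z. 0 \<le> \<psi> a z}" for a
  have cont: "continuous_on S (\<psi> a)" for a S
    by (cases a) (auto simp: \<psi>_def intro!: continuous_intros)
  have concave: "concave_on S (\<psi> a)" if "convex S" for a S
    using concave_on_linear_minus_dist_square[of "\<theta> / 2", OF _ that] \<open>\<theta> > 0\<close>
    by (cases a) (simp add: \<psi>_def)
  have sym: "\<psi> a (fst a') + \<psi> a' (fst a) \<ge> 0" if "a \<in> A" "a' \<in> A" for a a'
  proof -
    obtain y q y' q' where aa: "a = (y, q)" "a' = (y', q')" by fastforce
    have "blinfun_apply (q - q') (y - y') = blinfun_apply q (y - y') + blinfun_apply q' (y' - y)"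
      by (simp add: blinfun.diff_left blinfun.diff_right)
    then show ?thesis
      using mono[of y q y' q'] that by (simp add: aa \<psi>_def norm_minus_commute)
  qed
  obtain a0 where a0: "a0 \<in> A" using A by blast
  have "\<Inter>(K ` A) \<noteq> {}"
  proof (rule reflexive_bounded_closed_convex_fip[OF refl])
    fix M assume "M \<in> K ` A"
    then obtain a where "M = K a" by blast
    moreover have "closed {z. 0 \<le> \<psi> a z}"
      using cont by (intro closed_Collect_le continuous_on_const)
    moreover have "convex {z. 0 \<le> \<psi> a z}"
    proof (rule convexI)
      fix z w and u v :: real
      assume "z \<in> {z. 0 \<le> \<psi> a z}" "w \<in> {z. 0 \<le> \<psi> a z}" and uv: "0 \<le> u" "0 \<le> v" "u + v = 1"
      then have "0 \<le> u * \<psi> a z + v * \<psi> a w" by simp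
      also have "\<dots> \<le> \<psi> a (u *\<^sub>R z + v *\<^sub>R w)"
        using concave[of UNIV a] uv by (auto simp: concave_on_iff)
      finally show "u *\<^sub>R z + v *\<^sub>R w \<in> {z. 0 \<le> \<psi> a z}" by simp
    qed
    ultimately show "closed M \<and> convex M"
      using X by (simp add: K_def closed_Int convex_Int)
  next
    show "K a0 \<in> K ` A" using a0 by simp
    obtain y q where yq: "a0 = (y, q)" by fastforce
    have "norm (y - z) \<le> 2 * norm q / \<theta>" if "z \<in> K a0" for z
    proof (cases "norm (y - z) = 0")
      case False
      have "\<theta> / 2 * (norm (y - z))\<^sup>2 \<le> blinfun_apply q (y - z)"
        using that by (simp add: K_def \<psi>_def yq)
      also have "\<dots> \<le> norm q * norm (y - z)"
        using norm_blinfun[of q "y - z"] by simp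
      finally have "\<theta> / 2 * norm (y - z) \<le> norm q"
        using False by (simp add: power2_eq_square)
      then show ?thesis using \<open>\<theta> > 0\<close> by (simp add: field_simps)
    qed (use \<open>\<theta> > 0\<close> in simp)
    then show "bounded (K a0)"
      unfolding bounded_def dist_norm by blast
  next
    fix \<F> assume "finite \<F>" "\<F> \<subseteq> K ` A"
    then obtain I where I: "I \<subseteq> A" "finite I" "\<F> = K ` I"
      using finite_subset_image by metis
    let ?I = "insert a0 I"
    obtain z where z: "z \<in> convex hull (fst ` ?I)" "\<forall>a\<in>?I. \<psi> a z \<ge> 0"
    proof (rule concave_family_common_nonneg_point[of ?I fst \<psi>])
      show "\<psi> i (fst k) + \<psi> k (fst i) \<ge> 0" if "i \<in> ?I" "k \<in> ?I" for i k
        using that I a0 by (intro sym) auto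
    qed (use I cont concave in \<open>simp_all add: that\<close>)
    have "convex hull (fst ` ?I) \<subseteq> X"
      using A(2) I a0 X(2) by (intro hull_minimal) auto
    with z I show "K a0 \<inter> \<Inter>\<F> \<noteq> {}"
      by (auto simp: K_def)
  qed
  then obtain z where z: "\<And>a. a \<in> A \<Longrightarrow> z \<in> K a" by blast
  have "z \<in> X" using z[OF a0] by (simp add: K_def)
  moreover have "blinfun_apply q (y - z) \<ge> 0" if "(y, q) \<in> A" for y q
  proof -
    have "\<theta> / 2 * (norm (y - z))\<^sup>2 \<le> blinfun_apply q (y - z)"
      using z[OF that] by (simp add: K_def \<psi>_def)
    moreover have "0 \<le> \<theta> / 2 * (norm (y - z))\<^sup>2" using \<open>\<theta> > 0\<close> by simp
    ultimately show ?thesis by linarith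
  qed
  ultimately show thesis by (intro that[of z]) auto
qed

section \<open>Finite powers of a reflexive space\<close>

lemma bounded_linear_axis: "bounded_linear (axis j :: 'a::real_normed_vector \<Rightarrow> 'a ^ 'n::finite)"
proof (rule bounded_linear_intro[where K = 1])
  fix x y :: 'a and c :: real
  show "axis j (x + y) = (axis j x + axis j y :: 'a ^ 'n)"
    and "axis j (c *\<^sub>R x) = (c *\<^sub>R axis j x :: 'a ^ 'n)"
    by (simp_all add: axis_def vec_eq_iff)
  have "norm (axis j x :: 'a ^ 'n) \<le> (\<Sum>i\<in>UNIV. norm ((axis j x :: 'a ^ 'n) $ i))"
    unfolding norm_vec_def by (rule L2_set_le_sum) simp
  also have "\<dots> = (\<Sum>i\<in>UNIV. if i = j then norm x else 0)"
    by (intro sum.cong refl) (simp add: axis_def)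
  finally show "norm (axis j x :: 'a ^ 'n) \<le> norm x * 1" by simp
qed

definition coord_proj :: "'n::finite \<Rightarrow> ('a::real_normed_vector ^ 'n) \<Rightarrow>\<^sub>L 'a" where
  "coord_proj j = Blinfun (\<lambda>x. x $ j)"

definition coord_incl :: "'n::finite \<Rightarrow> 'a::real_normed_vector \<Rightarrow>\<^sub>L ('a ^ 'n)" where
  "coord_incl j = Blinfun (axis j)"

lemma coord_proj_apply [simp]: "blinfun_apply (coord_proj j) x = x $ j"
  by (simp add: coord_proj_def bounded_linear_Blinfun_apply bounded_linear_vec_nth)

lemma coord_incl_apply [simp]: "blinfun_apply (coord_incl j) x = axis j x"
  by (simp add: coord_incl_def bounded_linear_Blinfun_apply bounded_linear_axis)

lemma sum_axis: "(\<Sum>j\<in>UNIV. axis j (x $ j)) = (x :: 'a::real_normed_vector ^ 'n::finite)"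
  by (simp add: vec_eq_iff axis_def)

lemma blinfun_apply_vec:
  fixes \<zeta> :: "('a::real_normed_vector ^ 'n::finite) \<Rightarrow>\<^sub>L 'b::real_normed_vector"
  shows "blinfun_apply \<zeta> x = (\<Sum>j\<in>UNIV. blinfun_apply (\<zeta> o\<^sub>L coord_incl j) (x $ j))"
proof -
  have "blinfun_apply \<zeta> x = blinfun_apply \<zeta> (\<Sum>j\<in>UNIV. axis j (x $ j))"
    by (simp only: sum_axis)
  then show ?thesis by (simp add: blinfun.sum_right)
qed

text \<open>
  A functional on the dual of the power splits into functionals on the dual of the factor, each of
  which is an evaluation.
\<close>

lemma reflexive_space_vec:
  assumes "reflexive_space TYPE('a::real_normed_vector)"
  shows "reflexive_space TYPE('a ^ 'n::finite)"
  unfolding reflexive_space_def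
proof
  fix \<phi> :: "(('a ^ 'n) \<Rightarrow>\<^sub>L real) \<Rightarrow>\<^sub>L real"
  have "\<exists>w. \<forall>\<xi>. blinfun_apply \<phi> (\<xi> o\<^sub>L coord_proj j) = blinfun_apply \<xi> w" for j :: 'n
  proof -
    have "bounded_linear (\<lambda>\<xi>::'a \<Rightarrow>\<^sub>L real. blinfun_apply \<phi> (\<xi> o\<^sub>L coord_proj j))"
      by (intro bounded_linear_compose[OF blinfun.bounded_linear_right]
          bounded_bilinear.bounded_linear_left[OF bounded_bilinear_blinfun_compose])
    then have "blinfun_apply \<phi> (\<xi> o\<^sub>L coord_proj j)
        = blinfun_apply (Blinfun (\<lambda>\<xi>. blinfun_apply \<phi> (\<xi> o\<^sub>L coord_proj j))) \<xi>" for \<xi> :: "'a \<Rightarrow>\<^sub>L real"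
      by (simp add: bounded_linear_Blinfun_apply)
    then show ?thesis
      using assms unfolding reflexive_space_def by metis
  qed
  then obtain x where x: "\<And>j \<xi>. blinfun_apply \<phi> (\<xi> o\<^sub>L coord_proj j) = blinfun_apply \<xi> (x j)"
    by metis
  have "blinfun_apply \<phi> \<zeta> = blinfun_apply \<zeta> (\<chi> j. x j)" for \<zeta>
  proof -
    have "\<zeta> = (\<Sum>j\<in>UNIV. (\<zeta> o\<^sub>L coord_incl j) o\<^sub>L coord_proj j)"
      by (rule blinfun_eqI, subst blinfun_apply_vec) (simp add: blinfun.sum_left)
    then have "blinfun_apply \<phi> \<zeta>
        = (\<Sum>j\<in>UNIV. blinfun_apply \<phi> ((\<zeta> o\<^sub>L coord_incl j) o\<^sub>L coord_proj j))"
      by (metis blinfun.sum_right)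
    also have "\<dots> = blinfun_apply \<zeta> (\<chi> j. x j)"
      by (subst blinfun_apply_vec) (simp only: x vec_lambda_beta)
    finally show ?thesis .
  qed
  then show "\<exists>x. \<forall>\<zeta>. blinfun_apply \<phi> \<zeta> = blinfun_apply \<zeta> x" by blast
qed

section \<open>Semicontinuity\<close>

text \<open>
  Semicontinuity and continuity of the costs are used along segments, which converge in norm; this
  is how the weak versions pass to the norm topology.
\<close>

lemma openin_weak_topology_imp_open:
  assumes "openin weak_topology U"
  shows "open U"
proof -
  have "generate_topology_on {blinfun_apply \<phi> -` U | (\<phi> :: 'a \<Rightarrow>\<^sub>L real) U. open U} U"
    using assms by (simp add: weak_topology_def openin_topology_generated_by)
  then show ?thesis
  proof induction
    case (Basis s)
    then obtain \<phi> :: "'a \<Rightarrow>\<^sub>L real" and V where "s = blinfun_apply \<phi> -` V" "open V" by blast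
    then show ?case
      by (simp add: open_vimage linear_continuous_on blinfun.bounded_linear_right)
  qed auto
qed

lemma openin_weak_subtopology_imp:
  "openin (subtopology weak_topology S) U \<Longrightarrow> openin (top_of_set S) U"
  by (metis openin_subtopology open_openin openin_weak_topology_imp_open)

definition lsc_on :: "'a::topological_space set \<Rightarrow> ('a \<Rightarrow> real) \<Rightarrow> bool" where
  "lsc_on S g \<longleftrightarrow> (\<forall>c. openin (top_of_set S) {x \<in> S. c < g x})"

lemma weakly_lsc_imp_lsc: "weakly_lsc_on S g \<Longrightarrow> lsc_on S g"
  by (simp add: weakly_lsc_on_def lsc_on_def openin_weak_subtopology_imp)

lemma weakly_continuous_imp_continuous:
  assumes "weakly_continuous_on S g"
  shows "continuous_on S g"
proof -
  have "openin (subtopology weak_topology S)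
      {x \<in> topspace (subtopology weak_topology S). g x \<in> U}" if "open U" for U
    using assms that by (simp add: weakly_continuous_on_def continuous_map_def)
  moreover have "topspace (subtopology weak_topology S) = S"
  proof -
    have "openin weak_topology (blinfun_apply (0 :: 'a \<Rightarrow>\<^sub>L real) -` UNIV)"
      unfolding weak_topology_def by (intro topology_generated_by_Basis) blast
    then have "topspace (weak_topology :: 'a topology) = UNIV"
      using openin_subset by fastforce
    then show ?thesis by simp
  qed
  ultimately have "openin (top_of_set S) {x \<in> S. g x \<in> U}" if "open U" for U
    using that openin_weak_subtopology_imp by metis
  then show ?thesis
    unfolding continuous_openin_preimage_eq by (simp add: Collect_conj_eq vimage_def)
qed

lemma lsc_on_compose:
  assumes "lsc_on S g" "continuous_on T h" "h \<in> T \<rightarrow> S"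
  shows "lsc_on T (\<lambda>x. g (h x))"
  unfolding lsc_on_def
proof
  fix c
  have "openin (top_of_set T) (T \<inter> h -` {x \<in> S. c < g x})"
    using assms by (intro continuous_openin_preimage) (auto simp: lsc_on_def)
  moreover have "T \<inter> h -` {x \<in> S. c < g x} = {x \<in> T. c < g (h x)}"
    using assms(3) by auto
  ultimately show "openin (top_of_set T) {x \<in> T. c < g (h x)}" by simp
qed

lemma lsc_on_add:
  assumes "lsc_on S g" "lsc_on S h"
  shows "lsc_on S (\<lambda>x. g x + h x)"
  unfolding lsc_on_def
proof
  fix c
  have "{x \<in> S. c < g x + h x} = (\<Union>d. {x \<in> S. d < g x} \<inter> {x \<in> S. c - d < h x})"
  proof (intro equalityI subsetI)
    fix x assume "x \<in> {x \<in> S. c < g x + h x}"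
    then have "x \<in> {x \<in> S. g x - (g x + h x - c) / 2 < g x}
        \<inter> {x \<in> S. c - (g x - (g x + h x - c) / 2) < h x}"
      by (auto simp: field_simps)
    then show "x \<in> (\<Union>d. {x \<in> S. d < g x} \<inter> {x \<in> S. c - d < h x})" by blast
  qed auto
  then show "openin (top_of_set S) {x \<in> S. c < g x + h x}"
    using assms by (auto simp: lsc_on_def intro!: openin_Union openin_Int)
qed

lemma lsc_on_sum:
  "finite I \<Longrightarrow> (\<And>i. i \<in> I \<Longrightarrow> lsc_on S (g i)) \<Longrightarrow> lsc_on S (\<lambda>x. \<Sum>i\<in>I. g i x)"
proof (induction I rule: finite_induct)
  case empty
  have "openin (top_of_set S) {x \<in> S. c < (0::real)}" for c
    by (cases "c < 0") auto
  then show ?case by (simp add: lsc_on_def)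
next
  case (insert i I)
  then show ?case by (simp add: lsc_on_add)
qed

lemma lsc_on_closed_sublevel:
  assumes "lsc_on S g" "closed S"
  shows "closed {x \<in> S. g x \<le> c}"
proof -
  have "closedin (top_of_set S) (S - {x \<in> S. c < g x})"
    using assms(1) by (auto simp: lsc_on_def)
  moreover have "S - {x \<in> S. c < g x} = {x \<in> S. g x \<le> c}" by auto
  ultimately show ?thesis using assms(2) closedin_closed_trans by metis
qed

text \<open>
  Lower semicontinuity along a filter, combined with an upper bound for the values that
  itself converges.
\<close>

lemma lsc_on_le_of_tendsto:
  assumes g: "lsc_on S g" and F: "F \<noteq> bot" and v: "(v \<longlongrightarrow> x) F" "x \<in> S"
    and ev: "\<forall>\<^sub>F t in F. v t \<in> S \<and> g (v t) \<le> h t" and h: "(h \<longlongrightarrow> l) F"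
  shows "g x \<le> l"
proof (rule ccontr)
  assume "\<not> g x \<le> l"
  then obtain c where c: "l < c" "c < g x" using dense[of l "g x"] by auto
  obtain U where U: "open U" "{x \<in> S. c < g x} = S \<inter> U"
    using g unfolding lsc_on_def openin_open by metis
  have "x \<in> U" using U(2) c(2) v(2) by blast
  then have "\<forall>\<^sub>F t in F. v t \<in> U"
    by (rule topological_tendstoD[OF v(1) U(1)])
  moreover have "\<forall>\<^sub>F t in F. h t < c"
    using h c(1) by (rule order_tendstoD)
  ultimately have "\<forall>\<^sub>F t in F. False"
    using ev
  proof eventually_elim
    case (elim t)
    then have "v t \<in> {x \<in> S. c < g x}" unfolding U(2) by blast
    with elim show False by simp
  qed
  with F show False by simp
qed

section \<open>Existence of Nash equilibria\<close>

text \<open>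
  The Nikaido--Isoda function of the game: the players' total cost if each of them deviates from
  \<open>x\<close> to \<open>y\<close> on their own.
\<close>

definition total_cost :: "('n::finite \<Rightarrow> 'v ^ 'n \<Rightarrow> real) \<Rightarrow> 'v ^ 'n \<Rightarrow> 'v ^ 'n \<Rightarrow> real" where
  "total_cost f x y = (\<Sum>j\<in>UNIV. f j (replace_coord x j (y $ j)))"

lemma replace_coord_nth [simp]: "replace_coord x j w $ k = (if k = j then w else x $ k)"
  by (simp add: replace_coord_def)

lemma replace_coord_self [simp]: "replace_coord x j (x $ j) = x"
  by (simp add: replace_coord_def vec_eq_iff)

lemma replace_coord_in_strategies:
  "x \<in> strategies Xs \<Longrightarrow> w \<in> Xs j \<Longrightarrow> replace_coord x j w \<in> strategies Xs"
  by (simp add: replace_coord_def strategies_def)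

lemma replace_coord_diff:
  "replace_coord x j w - x = axis j (w - x $ j :: 'a::ab_group_add)"
  by (simp add: replace_coord_def axis_def vec_eq_iff)

lemma total_cost_diag: "total_cost f x x = (\<Sum>j\<in>UNIV. f j x)"
  by (simp add: total_cost_def)

lemma total_cost_deviation:
  "total_cost f x (replace_coord x j w) = total_cost f x x + (f j (replace_coord x j w) - f j x)"
proof -
  have "total_cost f x (replace_coord x j w)
      = (\<Sum>k\<in>UNIV. f k x + (if k = j then f j (replace_coord x j w) - f j x else 0))"
    unfolding total_cost_def by (intro sum.cong refl) simp
  then show ?thesis by (simp add: total_cost_diag sum.distrib)
qed

lemma nash_equilibrium_iff_total_cost:
  "nash_equilibrium Xs f x \<longleftrightarrow>
    x \<in> strategies Xs \<and> (\<forall>y\<in>strategies Xs. total_cost f x x \<le> total_cost f x y)"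
proof
  assume x: "nash_equilibrium Xs f x"
  have "total_cost f x x \<le> total_cost f x y" if "y \<in> strategies Xs" for y
    unfolding total_cost_diag unfolding total_cost_def
    using x that by (intro sum_mono) (auto simp: nash_equilibrium_def strategies_def)
  with x show "x \<in> strategies Xs \<and> (\<forall>y\<in>strategies Xs. total_cost f x x \<le> total_cost f x y)"
    by (simp add: nash_equilibrium_def)
next
  assume x: "x \<in> strategies Xs \<and> (\<forall>y\<in>strategies Xs. total_cost f x x \<le> total_cost f x y)"
  have "f j x \<le> f j (replace_coord x j w)" if "w \<in> Xs j" for j w
  proof -
    have "total_cost f x x \<le> total_cost f x (replace_coord x j w)"
      using x that by (simp add: replace_coord_in_strategies)
    then show ?thesis by (simp add: total_cost_deviation)
  qed
  with x show "nash_equilibrium Xs f x" by (simp add: nash_equilibrium_def)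
qed

text \<open>
  Testing with unilateral deviations splits a subgradient of the total cost into subgradients for
  the single players.
\<close>

lemma subgradient_coord_in_partial_subdiff:
  assumes x: "x \<in> strategies Xs"
    and q: "\<forall>y\<in>strategies Xs. total_cost f x x + blinfun_apply q (y - x) \<le> total_cost f x y"
  shows "q o\<^sub>L coord_incl j \<in> partial_subdiff Xs f j x"
proof -
  have "f j x + blinfun_apply (q o\<^sub>L coord_incl j) (w - x $ j) \<le> f j (replace_coord x j w)"
    if "w \<in> Xs j" for w
    using bspec[OF q replace_coord_in_strategies[of x Xs w j, OF x that]]
    by (simp add: total_cost_deviation replace_coord_diff)
  then show ?thesis by (simp add: partial_subdiff_def)
qed

text \<open>
  The subdifferential refers to the strategy set, so the optimality of each player's strategy is
  literally that zero is a subgradient.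
\<close>

lemma zero_in_partial_subdiff_of_nash:
  "nash_equilibrium Xs f z \<Longrightarrow> 0 \<in> partial_subdiff Xs f j z"
  by (simp add: partial_subdiff_def nash_equilibrium_def)

lemma strategies_eq: "strategies Xs = (\<Inter>j. (\<lambda>x. x $ j) -` Xs j)"
  by (auto simp: strategies_def)

lemma closed_strategies: "(\<And>j. closed (Xs j)) \<Longrightarrow> closed (strategies Xs)"
  unfolding strategies_eq by (intro closed_INT ballI closed_vimage_vec_nth)

lemma convex_strategies: "(\<And>j. convex (Xs j)) \<Longrightarrow> convex (strategies Xs)"
  by (auto simp: strategies_def convex_def)

lemma interior_strategies_nonempty:
  fixes Xs :: "'n::finite \<Rightarrow> 'v::real_normed_vector set"
  assumes "\<And>j. interior (Xs j) \<noteq> {}"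
  shows "interior (strategies Xs) \<noteq> {}"
proof -
  let ?U = "strategies (\<lambda>j. interior (Xs j))"
  have "open ?U"
    unfolding strategies_eq by (intro open_INT ballI open_vimage_vec_nth) auto
  moreover have "?U \<subseteq> strategies Xs"
    using interior_subset by (fastforce simp: strategies_def)
  moreover have "?U \<noteq> {}"
  proof -
    obtain w where "\<And>j. w j \<in> interior (Xs j)"
      using assms by (meson ex_in_conv)
    then have "(\<chi> j. w j) \<in> ?U" by (simp add: strategies_def)
    then show ?thesis by blast
  qed
  ultimately show ?thesis
    using interior_maximal by blast
qed

lemma lsc_on_total_cost:
  fixes f :: "'n::finite \<Rightarrow> 'v::real_normed_vector ^ 'n \<Rightarrow> real"
  assumes "\<And>j. lsc_on (strategies Xs) (f j)" and x: "x \<in> strategies Xs"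
  shows "lsc_on (strategies Xs) (total_cost f x)"
proof -
  have "lsc_on (strategies Xs) (\<lambda>y. f j (replace_coord x j (y $ j)))" for j
  proof (rule lsc_on_compose[OF assms(1)])
    have "continuous_on (strategies Xs) (\<lambda>y. if k = j then y $ j else x $ k)" for k
      by (cases "k = j") (auto intro!: continuous_intros)
    then show "continuous_on (strategies Xs) (\<lambda>y. replace_coord x j (y $ j))"
      unfolding replace_coord_def by (intro continuous_on_vec_lambda)
    show "(\<lambda>y. replace_coord x j (y $ j)) \<in> strategies Xs \<rightarrow> strategies Xs"
      using x by (auto simp: strategies_def replace_coord_def)
  qed
  then have "lsc_on (strategies Xs) (\<lambda>y. \<Sum>j\<in>UNIV. f j (replace_coord x j (y $ j)))"
    by (intro lsc_on_sum) auto
  then show ?thesis by (simp add: total_cost_def[abs_def])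
qed

text \<open>
  Every point of \<open>S\<close> is the end of a segment of interior points, along which the convex function
  lies below its chord.
\<close>

lemma convex_on_le_of_interior_bound:
  fixes g :: "'a::real_normed_vector \<Rightarrow> real"
  assumes g: "convex_on S g" and "interior S \<noteq> {}" and m: "\<And>w. w \<in> interior S \<Longrightarrow> m \<le> g w"
    and "w \<in> S"
  shows "m \<le> g w"
proof -
  obtain c where c: "c \<in> interior S" using assms(2) by blast
  have S: "convex S" using g by (rule convex_on_imp_convex)
  have "m \<le> (1 - t) * g w + t * g c" if t: "0 < t" "t \<le> 1" for t
  proof -
    have "m \<le> g (w + t *\<^sub>R (c - w))"
      by (intro m interior_convex_shrink S c \<open>w \<in> S\<close> t)
    also have "w + t *\<^sub>R (c - w) = (1 - t) *\<^sub>R w + t *\<^sub>R c"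
      by (simp add: algebra_simps)
    also have "g \<dots> \<le> (1 - t) * g w + t * g c"
      using c interior_subset t \<open>w \<in> S\<close> by (intro convex_onD[OF g]) auto
    finally show ?thesis .
  qed
  then have "\<forall>\<^sub>F t in at_right 0. m \<le> (1 - t) * g w + t * g c"
    by (auto simp: eventually_at_right_field intro!: exI[of _ 1])
  moreover have "((\<lambda>t. (1 - t) * g w + t * g c) \<longlongrightarrow> (1 - 0) * g w + 0 * g c) (at_right 0)"
    by (intro tendsto_intros)
  ultimately have "m \<le> (1 - 0) * g w + 0 * g c"
    by (intro tendsto_lowerbound) auto
  then show ?thesis by simp
qed

text \<open>
  Subgradients of the total cost exist at the interior points of the strategy set, and they form a
  strongly monotone set \<open>A\<close>; let \<open>z\<close> be the point that the Minty inequality yields.  For an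
  interior point \<open>w\<close> and \<open>v t = z + t *\<^sub>R (w - z)\<close>, a subgradient at \<open>v t\<close> is nonnegative in the
  direction \<open>w - z\<close>, hence also in the direction \<open>w - v t\<close>, which shows
  \<open>total_cost f (v t) (v t) \<le> total_cost f (v t) w\<close>.  As \<open>t\<close> tends to \<open>0\<close>, the left side can only
  drop in the limit and the right side converges.
\<close>

proposition nash_equilibrium_exists:
  fixes Xs :: "'n::finite \<Rightarrow> 'v::banach set" and f :: "'n \<Rightarrow> 'v ^ 'n \<Rightarrow> real"
  assumes refl: "reflexive_space TYPE('v)"
    and cl: "\<And>j. closed (Xs j)" and cv: "\<And>j. convex (Xs j)" and int: "\<And>j. interior (Xs j) \<noteq> {}"
    and lsc: "\<And>j. lsc_on (strategies Xs) (f j)"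
    and convex: "\<And>x. x \<in> strategies Xs \<Longrightarrow> convex_on (strategies Xs) (total_cost f x)"
    and cont: "\<And>y. y \<in> strategies Xs \<Longrightarrow> continuous_on (strategies Xs) (\<lambda>x. total_cost f x y)"
    and "\<theta> > 0"
    and mono: "\<And>x y p q. x \<in> strategies Xs \<Longrightarrow> y \<in> strategies Xs \<Longrightarrow>
      (\<And>j. p j \<in> partial_subdiff Xs f j x) \<Longrightarrow> (\<And>j. q j \<in> partial_subdiff Xs f j y) \<Longrightarrow>
      (\<Sum>j\<in>UNIV. blinfun_apply (p j - q j) (x $ j - y $ j)) \<ge> \<theta> * (norm (x - y))\<^sup>2"
  obtains z where "nash_equilibrium Xs f z"
proof -
  let ?X = "strategies Xs"
  have X: "closed ?X" "convex ?X" "interior ?X \<noteq> {}"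
    using cl cv int by (auto intro!: closed_strategies convex_strategies interior_strategies_nonempty)
  define A where "A = {(y, q). y \<in> interior ?X \<and>
    (\<forall>w\<in>?X. total_cost f y y + blinfun_apply q (w - y) \<le> total_cost f y w)}"
  have inX: "y \<in> ?X" if "y \<in> interior ?X" for y
    using that interior_subset by blast
  have subgrad: "\<exists>q. (y, q) \<in> A" if "y \<in> interior ?X" for y
  proof -
    have "\<exists>q. \<forall>w\<in>?X. total_cost f y y + blinfun_apply q (w - y) \<le> total_cost f y w"
    proof (rule convex_lsc_has_subgradient)
      show "closed {w \<in> ?X. total_cost f y w \<le> c}" for c
        using lsc_on_total_cost[OF lsc inX[OF that]] X(1) by (rule lsc_on_closed_sublevel)
    qed (use convex inX that in auto)
    then show ?thesis using that by (auto simp: A_def)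
  qed
  have A_mono: "\<theta> * (norm (y - y'))\<^sup>2 \<le> blinfun_apply (q - q') (y - y')"
    if "(y, q) \<in> A" "(y', q') \<in> A" for y q y' q'
  proof -
    have "\<theta> * (norm (y - y'))\<^sup>2
        \<le> (\<Sum>j\<in>UNIV. blinfun_apply ((q o\<^sub>L coord_incl j) - (q' o\<^sub>L coord_incl j)) (y $ j - y' $ j))"
      using that by (intro mono subgradient_coord_in_partial_subdiff) (auto simp: A_def inX)
    also have "\<dots> = (\<Sum>j\<in>UNIV. blinfun_apply ((q - q') o\<^sub>L coord_incl j) ((y - y') $ j))"
      by (rule sum.cong) (simp_all add: blinfun.diff_left)
    also have "\<dots> = blinfun_apply (q - q') (y - y')"
      by (rule blinfun_apply_vec[symmetric])
    finally show ?thesis .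
  qed
  obtain z where z: "z \<in> ?X" "\<forall>(y, q)\<in>A. blinfun_apply q (y - z) \<ge> 0"
  proof (rule strongly_monotone_minty_point[OF reflexive_space_vec[OF refl] X(1,2) _ _ \<open>\<theta> > 0\<close> A_mono])
    show "A \<noteq> {}" using subgrad X(3) by blast
    show "fst ` A \<subseteq> ?X" using inX by (auto simp: A_def)
  qed
  have "total_cost f z z \<le> total_cost f z w" if w: "w \<in> interior ?X" for w
  proof -
    define v where "v t = z + t *\<^sub>R (w - z)" for t
    have v: "v t \<in> interior ?X" "total_cost f (v t) (v t) \<le> total_cost f (v t) w"
      if t: "0 < t" "t \<le> 1" for t
    proof -
      show "v t \<in> interior ?X"
        unfolding v_def by (intro interior_convex_shrink X w z t)
      then obtain q where q: "(v t, q) \<in> A" using subgrad by blast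
      have "0 \<le> blinfun_apply q (v t - z)" using z(2) q by blast
      also have "\<dots> = t * blinfun_apply q (w - z)"
        by (simp add: v_def blinfun.scaleR_right)
      finally have "0 \<le> blinfun_apply q (w - z)"
        using t by (simp add: zero_le_mult_iff)
      then have "0 \<le> (1 - t) * blinfun_apply q (w - z)" using t by simp
      also have "\<dots> = blinfun_apply q ((1 - t) *\<^sub>R (w - z))"
        by (simp add: blinfun.scaleR_right)
      also have "(1 - t) *\<^sub>R (w - z) = w - v t"
        by (simp add: v_def algebra_simps)
      finally have "0 \<le> blinfun_apply q (w - v t)" .
      moreover have "total_cost f (v t) (v t) + blinfun_apply q (w - v t) \<le> total_cost f (v t) w"
        using q inX[OF w] by (simp add: A_def)
      ultimately show "total_cost f (v t) (v t) \<le> total_cost f (v t) w" by linarith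
    qed
    have "(v \<longlongrightarrow> z + 0 *\<^sub>R (w - z)) (at_right 0)"
      unfolding v_def by (intro tendsto_intros)
    then have v_lim: "(v \<longlongrightarrow> z) (at_right 0)" by simp
    have ev: "\<forall>\<^sub>F t in at_right 0. v t \<in> ?X \<and> total_cost f (v t) (v t) \<le> total_cost f (v t) w"
      using v inX by (auto simp: eventually_at_right_field intro!: exI[of _ 1])
    have "((\<lambda>t. total_cost f (v t) w) \<longlongrightarrow> total_cost f z w) (at_right 0)"
      using ev by (intro continuous_on_tendsto_compose[OF cont[OF inX[OF w]] v_lim z(1)])
        (auto elim: eventually_mono)
    moreover have "lsc_on ?X (\<lambda>x. total_cost f x x)"
      unfolding total_cost_diag using lsc by (intro lsc_on_sum) auto
    ultimately show ?thesis
      using v_lim z(1) ev by (intro lsc_on_le_of_tendsto[where F = "at_right 0" and v = v]) auto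
  qed
  then have "total_cost f z z \<le> total_cost f z w" if "w \<in> ?X" for w
    using convex_on_le_of_interior_bound[OF convex[OF z(1)] X(3) _ that] by blast
  with z(1) show thesis
    by (intro that[of z]) (simp add: nash_equilibrium_iff_total_cost)
qed

section \<open>Decay of Lipschitz curves\<close>

lemma lipschitz_on_mult_bounded:
  fixes f g :: "'a::metric_space \<Rightarrow> real"
  assumes f: "C-lipschitz_on S f" "\<And>x. x \<in> S \<Longrightarrow> \<bar>f x\<bar> \<le> A"
    and g: "D-lipschitz_on S g" "\<And>x. x \<in> S \<Longrightarrow> \<bar>g x\<bar> \<le> B" and "0 \<le> A" "0 \<le> B"
  shows "(A * D + B * C)-lipschitz_on S (\<lambda>x. f x * g x)"
proof (rule lipschitz_onI)
  show "0 \<le> A * D + B * C"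
    using assms lipschitz_on_nonneg[OF f(1)] lipschitz_on_nonneg[OF g(1)] by simp
  fix x y assume xy: "x \<in> S" "y \<in> S"
  have "f x * g x - f y * g y = f x * (g x - g y) + g y * (f x - f y)"
    by (simp add: algebra_simps)
  then have "\<bar>f x * g x - f y * g y\<bar> \<le> \<bar>f x\<bar> * \<bar>g x - g y\<bar> + \<bar>g y\<bar> * \<bar>f x - f y\<bar>"
    by (metis abs_mult abs_triangle_ineq)
  also have "\<dots> \<le> A * (D * dist x y) + B * (C * dist x y)"
    using lipschitz_onD[OF f(1) xy] lipschitz_onD[OF g(1) xy] f(2)[OF xy(1)] g(2)[OF xy(2)] assms
    by (intro add_mono mult_mono) (auto simp: dist_real_def)
  finally show "dist (f x * g x) (f y * g y) \<le> (A * D + B * C) * dist x y"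
    by (simp add: dist_real_def algebra_simps)
qed

text \<open>
  Subtracting a small multiple of \<open>t - a\<close> makes the derivatives negative while the value at
  \<open>b\<close> still exceeds the value at \<open>a\<close>.  The Lipschitz image of the null set \<open>N\<close> is null, so some
  intermediate value \<open>c\<close> is not attained on \<open>N\<close>.  At the last point \<open>s\<close> where it is attained the
  derivative is negative, and the function has to cross \<open>c\<close> once more on its way up to \<open>\<phi> b\<close>.
\<close>

proposition lipschitz_ae_nonpos_derivative_imp_le:
  fixes h :: "real \<Rightarrow> real"
  assumes lip: "L-lipschitz_on {a..b} h" and "a \<le> b" and N: "negligible N"
    and deriv: "\<And>t. t \<in> {a<..<b} - N \<Longrightarrow> \<exists>D\<le>0. (h has_real_derivative D) (at t)"
  shows "h b \<le> h a"
proof (rule ccontr)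
  assume "\<not> h b \<le> h a"
  then have "h a < h b" by simp
  with \<open>a \<le> b\<close> have "a < b" by (cases "a = b") auto
  define \<epsilon> where "\<epsilon> = (h b - h a) / 2 / (b - a)"
  have "\<epsilon> > 0" using \<open>h a < h b\<close> \<open>a < b\<close> by (simp add: \<epsilon>_def)
  define \<phi> where "\<phi> t = h t - \<epsilon> * (t - a)" for t
  have "(h b - h a) / 2 = \<epsilon> * (b - a)"
    using \<open>a < b\<close> nonzero_divide_eq_eq[of "b - a" "(h b - h a) / 2" \<epsilon>] by (simp only: \<epsilon>_def) simp
  then have ends: "\<phi> a < \<phi> b"
    using \<open>h a < h b\<close> by (simp add: \<phi>_def field_simps)
  have lip_\<phi>: "(L + \<epsilon>)-lipschitz_on {a..b} \<phi>"
  proof -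
    have "\<epsilon>-lipschitz_on {a..b} (\<lambda>t. \<epsilon> * (t - a))"
      using \<open>\<epsilon> > 0\<close> by (intro lipschitz_onI) (auto simp: dist_real_def simp flip: right_diff_distrib abs_mult_pos')
    then show ?thesis
      unfolding \<phi>_def by (intro lipschitz_on_diff lip)
  qed
  have "negligible (\<phi> ` (N \<inter> {a..b}))"
  proof (rule negligible_locally_Lipschitz_image)
    show "negligible (N \<inter> {a..b})" using N by (rule negligible_subset) auto
    show "\<exists>T B. open T \<and> x \<in> T \<and> (\<forall>y\<in>N \<inter> {a..b} \<inter> T. norm (\<phi> y - \<phi> x) \<le> B * norm (y - x))"
      if "x \<in> N \<inter> {a..b}" for x
      using that lipschitz_on_normD[OF lip_\<phi>]
      by (intro exI[of _ UNIV] exI[of _ "L + \<epsilon>"]) auto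
  qed simp
  moreover have "\<not> negligible {\<phi> a<..<\<phi> b}"
    using ends by (simp add: open_not_negligible)
  ultimately obtain c where c: "\<phi> a < c" "c < \<phi> b" "c \<notin> \<phi> ` (N \<inter> {a..b})"
    using negligible_subset by (metis greaterThanLessThan_iff subsetI)
  have cont: "continuous_on {a..b} \<phi>"
    using lip_\<phi> by (rule lipschitz_on_continuous_on)
  define E where "E = {t \<in> {a..b}. \<phi> t = c}"
  have "E \<noteq> {}"
    using IVT'[of \<phi> a c b] c \<open>a \<le> b\<close> cont by (auto simp: E_def)
  moreover have "compact E"
  proof -
    have "closed E"
      unfolding E_def by (intro continuous_closed_preimage_constant cont) simp
    moreover have "E \<subseteq> {a..b}" by (auto simp: E_def)
    ultimately show ?thesis by (metis compact_Icc compact_Int_closed inf.absorb_iff2)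
  qed
  ultimately obtain s where s: "s \<in> E" "\<forall>t\<in>E. t \<le> s"
    using compact_attains_sup by metis
  have "s \<in> {a<..<b}" using s(1) c by (auto simp: E_def less_le)
  moreover have "s \<notin> N" using s(1) c(3) by (auto simp: E_def)
  ultimately obtain D where D: "D \<le> 0" "(h has_real_derivative D) (at s)"
    using deriv[of s] by blast
  have "(\<phi> has_real_derivative D - \<epsilon>) (at s)"
    unfolding \<phi>_def by (auto intro!: derivative_eq_intros D(2))
  then obtain d where d: "d > 0" "\<And>e. 0 < e \<Longrightarrow> e < d \<Longrightarrow> \<phi> (s + e) < \<phi> s"
    using DERIV_neg_dec_right[of \<phi> "D - \<epsilon>" s] D(1) \<open>\<epsilon> > 0\<close> by auto
  define e where "e = min (d / 2) ((b - s) / 2)"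
  have e: "0 < e" "e < d" "s + e < b"
    using d(1) \<open>s \<in> {a<..<b}\<close> by (auto simp: e_def min_def field_simps)
  have "\<phi> (s + e) < c" using d(2)[OF e(1,2)] s(1) by (simp add: E_def)
  moreover have "continuous_on {s + e..b} \<phi>"
    using \<open>s \<in> {a<..<b}\<close> e by (intro continuous_on_subset[OF cont]) auto
  ultimately obtain t where "s + e \<le> t" "t \<le> b" "\<phi> t = c"
    using IVT'[of \<phi> "s + e" c b] c(2) e(3) by auto
  then have "t \<in> E" using e(1) \<open>s \<in> {a<..<b}\<close> by (auto simp: E_def)
  then show False using bspec[OF s(2), of t] \<open>s + e \<le> t\<close> e(1) by simp
qed

text \<open>
  On a bounded interval, \<open>exp (2 * \<kappa> * t) * (norm (u t - w))\<^sup>2\<close> is Lipschitz continuous, and its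
  derivative is nonpositive almost everywhere.
\<close>

proposition lipschitz_curve_exponential_decay:
  fixes u :: "real \<Rightarrow> 'h::real_inner"
  assumes lip: "L-lipschitz_on {0..} u" and N: "negligible N"
    and diss: "\<And>t. t > 0 \<Longrightarrow> t \<notin> N \<Longrightarrow>
      \<exists>du. (u has_vector_derivative du) (at t) \<and> du \<bullet> (u t - w) \<le> - \<kappa> * (norm (u t - w))\<^sup>2"
    and "0 \<le> T"
  shows "norm (u T - w) \<le> exp (- \<kappa> * T) * norm (u 0 - w)"
proof -
  define g where "g t = norm (u t - w)" for t
  define h where "h t = exp (2 * \<kappa> * t) * (g t * g t)" for t
  have L: "L \<ge> 0" using lip by (rule lipschitz_on_nonneg)
  have lip_g: "L-lipschitz_on {0..T} g"
  proof (rule lipschitz_onI[OF _ L])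
    fix s t assume "s \<in> {0..T}" "t \<in> {0..T}"
    then have "norm (u s - u t) \<le> L * dist s t"
      using lipschitz_onD[OF lip, of s t] by (simp add: dist_norm)
    moreover have "\<bar>g s - g t\<bar> \<le> norm ((u s - w) - (u t - w))"
      unfolding g_def by (rule norm_triangle_ineq3)
    ultimately show "dist (g s) (g t) \<le> L * dist s t"
      by (simp add: dist_real_def)
  qed
  define A where "A = g 0 + L * T"
  have "A \<ge> 0" using L \<open>0 \<le> T\<close> by (simp add: A_def g_def)
  have bound_g: "\<bar>g t\<bar> \<le> A" if "t \<in> {0..T}" for t
  proof -
    have "\<bar>g t - g 0\<bar> \<le> L * t"
      using lipschitz_onD[OF lip_g that, of 0] that by (simp add: dist_real_def)
    also have "\<dots> \<le> L * T" using that L by (intro mult_left_mono) auto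
    finally show ?thesis by (simp add: A_def g_def)
  qed
  have lip_gg: "(A * L + A * L)-lipschitz_on {0..T} (\<lambda>t. g t * g t)"
    using lip_g bound_g \<open>A \<ge> 0\<close> by (intro lipschitz_on_mult_bounded)
  have bound_gg: "\<bar>g t * g t\<bar> \<le> A * A" if "t \<in> {0..T}" for t
    unfolding abs_mult using bound_g[OF that] \<open>A \<ge> 0\<close> by (intro mult_mono) auto
  define M where "M = exp (\<bar>2 * \<kappa>\<bar> * T)"
  have "M > 0" by (simp add: M_def)
  have bound_exp: "\<bar>exp (2 * \<kappa> * t)\<bar> \<le> M" if "t \<in> {0..T}" for t
  proof -
    have "2 * \<kappa> * t \<le> \<bar>2 * \<kappa>\<bar> * T"
      using that by (intro mult_mono) auto
    then show ?thesis by (simp add: M_def)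
  qed
  have lip_exp: "(\<bar>2 * \<kappa>\<bar> * M)-lipschitz_on {0..T} (\<lambda>t. exp (2 * \<kappa> * t))"
  proof (rule bounded_derivative_imp_lipschitz)
    fix t assume t: "t \<in> {0..T}"
    show "((\<lambda>t. exp (2 * \<kappa> * t)) has_derivative (\<lambda>x. (2 * \<kappa> * exp (2 * \<kappa> * t)) * x)) (at t within {0..T})"
      by (auto intro!: derivative_eq_intros)
    have "\<bar>2 * \<kappa> * exp (2 * \<kappa> * t) * x\<bar> \<le> \<bar>2 * \<kappa>\<bar> * M * \<bar>x\<bar>" for x
      using bound_exp[OF t] \<open>M > 0\<close> unfolding abs_mult by (intro mult_mono) auto
    then show "onorm (\<lambda>x. (2 * \<kappa> * exp (2 * \<kappa> * t)) * x) \<le> \<bar>2 * \<kappa>\<bar> * M"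
      using \<open>M > 0\<close> by (intro onorm_bound) auto
  qed (use \<open>M > 0\<close> in auto)
  have lip_h: "(M * (A * L + A * L) + (A * A) * (\<bar>2 * \<kappa>\<bar> * M))-lipschitz_on {0..T} h"
    unfolding h_def
    by (rule lipschitz_on_mult_bounded[OF lip_exp bound_exp lip_gg bound_gg])
      (use \<open>A \<ge> 0\<close> \<open>M > 0\<close> in auto)
  have "h T \<le> h 0"
  proof (rule lipschitz_ae_nonpos_derivative_imp_le[OF lip_h \<open>0 \<le> T\<close> N])
    fix t assume t: "t \<in> {0<..<T} - N"
    then obtain du where du: "(u has_vector_derivative du) (at t)"
      "du \<bullet> (u t - w) \<le> - \<kappa> * (norm (u t - w))\<^sup>2"
      using diss[of t] by auto
    define E where "E s = (u s - w) \<bullet> (u s - w)" for s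
    have E: "g s * g s = E s" for s
      by (simp add: g_def E_def dot_square_norm power2_eq_square)
    have "(E has_real_derivative 2 * (du \<bullet> (u t - w))) (at t)"
      using du(1) unfolding E_def[abs_def] has_vector_derivative_def has_field_derivative_def
      by (auto intro!: derivative_eq_intros simp: inner_commute)
    moreover have "((\<lambda>s. exp (2 * \<kappa> * s)) has_real_derivative 2 * \<kappa> * exp (2 * \<kappa> * t)) (at t)"
      by (auto intro!: derivative_eq_intros)
    ultimately have "(h has_real_derivative
        2 * \<kappa> * exp (2 * \<kappa> * t) * E t + 2 * (du \<bullet> (u t - w)) * exp (2 * \<kappa> * t)) (at t)"
      unfolding h_def[abs_def] E by (rule DERIV_mult[rotated])
    then have "(h has_real_derivative
        2 * exp (2 * \<kappa> * t) * (\<kappa> * (norm (u t - w))\<^sup>2 + du \<bullet> (u t - w))) (at t)"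
      by (simp add: E_def power2_norm_eq_inner algebra_simps del: inner_diff_left inner_diff_right)
    moreover have "2 * exp (2 * \<kappa> * t) * (\<kappa> * (norm (u t - w))\<^sup>2 + du \<bullet> (u t - w)) \<le> 0"
      using du(2) by (intro mult_nonneg_nonpos) auto
    ultimately show "\<exists>D\<le>0. (h has_real_derivative D) (at t)" by blast
  qed
  then have "(exp (\<kappa> * T) * g T)\<^sup>2 \<le> (g 0)\<^sup>2"
    by (simp add: h_def power2_eq_square mult_exp_exp algebra_simps flip: exp_add)
  then have "exp (\<kappa> * T) * g T \<le> g 0"
    by (rule power2_le_imp_le) (simp add: g_def)
  then show ?thesis
    by (simp add: g_def exp_minus field_simps)
qed

section \<open>Equilibria and the flow\<close>

lemma norm_embed_prod_le:
  fixes \<iota> :: "'v::real_normed_vector \<Rightarrow>\<^sub>L 'h::real_normed_vector" and x :: "'v ^ 'n::finite"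
  shows "norm (embed_prod \<iota> x) \<le> norm \<iota> * norm x"
proof -
  have "norm (embed_prod \<iota> x) \<le> L2_set (\<lambda>j. norm \<iota> * norm (x $ j)) UNIV"
    unfolding norm_vec_def by (rule L2_set_mono) (simp_all add: embed_prod_def norm_blinfun)
  also have "\<dots> = norm \<iota> * norm x"
    by (simp add: norm_vec_def L2_set_right_distrib)
  finally show ?thesis .
qed

lemma embed_prod_diff: "embed_prod \<iota> x - embed_prod \<iota> y = embed_prod \<iota> (x - y)"
  by (simp add: embed_prod_def vec_eq_iff blinfun.diff_right)

text \<open>
  Test the inequality with the equilibrium itself.
\<close>

lemma variational_ineq_dissipation:
  fixes \<iota> :: "'v::real_normed_vector \<Rightarrow>\<^sub>L 'h::real_inner" and Xs :: "'n::finite \<Rightarrow> 'v set"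
  assumes z: "nash_equilibrium Xs f z"
    and ineq: "\<forall>y\<in>strategies Xs.
      (\<Sum>j\<in>UNIV. blinfun_apply (to_dual \<iota> (du $ j) + p j) (y $ j - x $ j)) \<ge> 0"
    and mono: "(\<Sum>j\<in>UNIV. blinfun_apply (p j) (x $ j - z $ j)) \<ge> m"
  shows "du \<bullet> (embed_prod \<iota> x - embed_prod \<iota> z) \<le> - m"
proof -
  have "z \<in> strategies Xs" using z by (simp add: nash_equilibrium_def)
  then have "0 \<le> (\<Sum>j\<in>UNIV. blinfun_apply (to_dual \<iota> (du $ j) + p j) (z $ j - x $ j))"
    using ineq by blast
  also have "\<dots> = (\<Sum>j\<in>UNIV. - (du $ j \<bullet> (embed_prod \<iota> x - embed_prod \<iota> z) $ j)
      - blinfun_apply (p j) (x $ j - z $ j))"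
    by (intro sum.cong refl)
      (simp add: to_dual_def embed_prod_def blinfun.add_left blinfun.diff_right inner_diff_right)
  also have "\<dots> = - (du \<bullet> (embed_prod \<iota> x - embed_prod \<iota> z))
      - (\<Sum>j\<in>UNIV. blinfun_apply (p j) (x $ j - z $ j))"
    by (simp add: inner_vec_def sum_subtractf sum_negf)
  finally show ?thesis using mono by simp
qed

theorem corollary2p6:
  fixes \<iota> :: "'v::banach \<Rightarrow>\<^sub>L 'h::{real_inner, complete_space}"
    and Xs :: "'n::finite \<Rightarrow> 'v set"
    and f :: "'n \<Rightarrow> 'v ^ 'n \<Rightarrow> real"
  assumes "reflexive_space TYPE('v)"
    and "embedded_triple \<iota>"
    and "\<And>j. closed (Xs j)"
    and "\<And>j. convex (Xs j)"
    and "\<And>j. interior (Xs j) \<noteq> {}"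
    and a: "\<And>j. weakly_lsc_on (strategies Xs) (f j)"
    and b: "\<And>x. x \<in> strategies Xs \<Longrightarrow>
      convex_on (strategies Xs) (\<lambda>y. \<Sum>j\<in>UNIV. f j (replace_coord x j (y $ j)))"
    and c: "\<And>y. y \<in> strategies Xs \<Longrightarrow>
      weakly_continuous_on (strategies Xs) (\<lambda>x. \<Sum>j\<in>UNIV. f j (replace_coord x j (y $ j)))"
    and d: "\<exists>\<theta>>0. \<forall>x\<in>strategies Xs. \<forall>y\<in>strategies Xs. \<forall>p q.
      (\<forall>j. p j \<in> partial_subdiff Xs f j x \<and> q j \<in> partial_subdiff Xs f j y) \<longrightarrow>
      (\<Sum>j\<in>UNIV. blinfun_apply (p j - q j) (x $ j - y $ j)) \<ge> \<theta> * (norm (x - y))\<^sup>2"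
  shows "(\<exists>!z. nash_equilibrium Xs f z) \<and>
    (\<forall>z (u :: real \<Rightarrow> 'h ^ 'n) u0.
      nash_equilibrium Xs f z \<and>
      (\<exists>L. L-lipschitz_on {0..} u) \<and>
      (\<forall>t\<ge>0. u t \<in> embed_prod \<iota> ` evolution_domain \<iota> Xs f) \<and>
      u0 \<in> embed_prod \<iota> ` evolution_domain \<iota> Xs f \<and> u 0 = u0 \<and>
      solves_variational_ineq \<iota> Xs f u \<longrightarrow>
      (\<exists>\<kappa>>0. \<forall>t\<ge>0.
        norm (u t - embed_prod \<iota> z) \<le> exp (- \<kappa> * t) * norm (u 0 - embed_prod \<iota> z)))"
proof -
  let ?X = "strategies Xs"
  obtain \<theta> where "\<theta> > 0" and \<theta>: "\<forall>x\<in>?X. \<forall>y\<in>?X. \<forall>p q.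
      (\<forall>j. p j \<in> partial_subdiff Xs f j x \<and> q j \<in> partial_subdiff Xs f j y) \<longrightarrow>
      (\<Sum>j\<in>UNIV. blinfun_apply (p j - q j) (x $ j - y $ j)) \<ge> \<theta> * (norm (x - y))\<^sup>2"
    using d by (elim exE conjE)
  have mono: "(\<Sum>j\<in>UNIV. blinfun_apply (p j - q j) (x $ j - y $ j)) \<ge> \<theta> * (norm (x - y))\<^sup>2"
    if "x \<in> ?X" "y \<in> ?X" "\<And>j. p j \<in> partial_subdiff Xs f j x" "\<And>j. q j \<in> partial_subdiff Xs f j y"
    for x y p q
    using bspec[OF bspec[OF \<theta> that(1)] that(2)] that(3,4) by simp
  have zero: "0 \<in> partial_subdiff Xs f j z" if "nash_equilibrium Xs f z" for j z
    using that by (rule zero_in_partial_subdiff_of_nash)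
  have nash_in: "z \<in> ?X" if "nash_equilibrium Xs f z" for z
    using that by (simp add: nash_equilibrium_def)
  obtain z0 where z0: "nash_equilibrium Xs f z0"
  proof (rule nash_equilibrium_exists[OF assms(1,3-5) _ _ _ \<open>\<theta> > 0\<close> mono])
    show "lsc_on ?X (f j)" for j
      using a by (rule weakly_lsc_imp_lsc)
    show "convex_on ?X (total_cost f x)" if "x \<in> ?X" for x
      using b[OF that] by (simp add: total_cost_def[abs_def])
    show "continuous_on ?X (\<lambda>x. total_cost f x y)" if "y \<in> ?X" for y
      using weakly_continuous_imp_continuous[OF c[OF that]] by (simp add: total_cost_def)
  qed
  have unique: "z = z'" if "nash_equilibrium Xs f z" "nash_equilibrium Xs f z'" for z z'
  proof -
    have "\<theta> * (norm (z - z'))\<^sup>2 \<le> 0"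
      using mono[of z z' "\<lambda>_. 0" "\<lambda>_. 0"] that zero nash_in by simp
    then show ?thesis using \<open>\<theta> > 0\<close> by (simp add: mult_le_0_iff)
  qed
  have decay: "\<exists>\<kappa>>0. \<forall>t\<ge>0.
      norm (u t - embed_prod \<iota> z) \<le> exp (- \<kappa> * t) * norm (u 0 - embed_prod \<iota> z)"
    if z: "nash_equilibrium Xs f z" and lip: "L-lipschitz_on {0..} u"
      and sol: "solves_variational_ineq \<iota> Xs f u" for z u L
  proof -
    \<comment> \<open>adding \<open>1\<close> keeps the constant positive if \<open>\<iota>\<close> vanishes\<close>
    define C where "C = norm \<iota> + 1"
    have "C > 0" by (simp add: C_def add_nonneg_pos)
    define \<kappa> where "\<kappa> = \<theta> / C\<^sup>2"
    have "\<kappa> > 0" using \<open>\<theta> > 0\<close> \<open>C > 0\<close> by (simp add: \<kappa>_def)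
    have coercive: "\<kappa> * (norm (embed_prod \<iota> x - embed_prod \<iota> z))\<^sup>2 \<le> \<theta> * (norm (x - z))\<^sup>2" for x
    proof -
      have "norm (embed_prod \<iota> x - embed_prod \<iota> z) \<le> norm \<iota> * norm (x - z)"
        unfolding embed_prod_diff by (rule norm_embed_prod_le)
      also have "\<dots> \<le> C * norm (x - z)"
        by (intro mult_right_mono) (auto simp: C_def)
      finally have "(norm (embed_prod \<iota> x - embed_prod \<iota> z))\<^sup>2 \<le> C\<^sup>2 * (norm (x - z))\<^sup>2"
        by (metis norm_ge_zero power_mono power_mult_distrib)
      then have "\<kappa> * (norm (embed_prod \<iota> x - embed_prod \<iota> z))\<^sup>2 \<le> \<kappa> * (C\<^sup>2 * (norm (x - z))\<^sup>2)"
        using \<open>\<kappa> > 0\<close> by (intro mult_left_mono) auto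
      then show ?thesis using \<open>C > 0\<close> by (simp add: \<kappa>_def)
    qed
    obtain N where N: "N \<in> null_sets lborel" and ae: "\<And>t. t \<in> space lborel - N \<Longrightarrow> t \<ge> 0 \<longrightarrow>
      (\<exists>x\<in>?X. \<exists>du p. u t = embed_prod \<iota> x \<and>
        (u has_vector_derivative du) (at t within {0..}) \<and>
        (\<forall>j. p j \<in> partial_subdiff Xs f j x) \<and>
        (\<forall>y\<in>?X. (\<Sum>j\<in>UNIV. blinfun_apply (to_dual \<iota> (du $ j) + p j) (y $ j - x $ j)) \<ge> 0))"
      by (rule AE_E3[OF sol[unfolded solves_variational_ineq_def]]) (rule that)
    have "negligible N"
      using N by (simp add: negligible_iff_null_sets null_sets_completionI)
    have diss: "\<exists>du. (u has_vector_derivative du) (at t) \<and>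
        du \<bullet> (u t - embed_prod \<iota> z) \<le> - \<kappa> * (norm (u t - embed_prod \<iota> z))\<^sup>2"
      if t: "t > 0" "t \<notin> N" for t
    proof -
      have "\<exists>x\<in>?X. \<exists>du p. u t = embed_prod \<iota> x \<and>
        (u has_vector_derivative du) (at t within {0..}) \<and>
        (\<forall>j. p j \<in> partial_subdiff Xs f j x) \<and>
        (\<forall>y\<in>?X. (\<Sum>j\<in>UNIV. blinfun_apply (to_dual \<iota> (du $ j) + p j) (y $ j - x $ j)) \<ge> 0)"
        by (rule mp[OF ae]) (use t in auto)
      then obtain x du p where x: "x \<in> ?X" and ut: "u t = embed_prod \<iota> x"
        and du: "(u has_vector_derivative du) (at t within {0..})"
        and p: "\<forall>j. p j \<in> partial_subdiff Xs f j x"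
        and ineq: "\<forall>y\<in>?X. (\<Sum>j\<in>UNIV. blinfun_apply (to_dual \<iota> (du $ j) + p j) (y $ j - x $ j)) \<ge> 0"
        by (elim bexE exE conjE)
      have "t \<in> interior {0..}" using t(1) by simp
      then have "at t within {0..} = at t"
        by (rule at_within_interior)
      with du have "(u has_vector_derivative du) (at t)" by metis
      moreover have "\<theta> * (norm (x - z))\<^sup>2 \<le> (\<Sum>j\<in>UNIV. blinfun_apply (p j) (x $ j - z $ j))"
        using mono[OF x nash_in[OF z], of p "\<lambda>_. 0"] p zero[OF z] by simp
      then have "du \<bullet> (u t - embed_prod \<iota> z) \<le> - (\<theta> * (norm (x - z))\<^sup>2)"
        unfolding ut by (rule variational_ineq_dissipation[OF z ineq])
      ultimately show ?thesis
        using coercive[of x] unfolding ut by (intro exI[of _ du]) simp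
    qed
    show ?thesis
      using \<open>\<kappa> > 0\<close> lipschitz_curve_exponential_decay[OF lip \<open>negligible N\<close> diss]
      by (intro exI[of _ \<kappa>]) simp
  qed
  show ?thesis
  proof (intro conjI allI impI)
    show "\<exists>!z. nash_equilibrium Xs f z"
      using z0 unique[OF _ z0] by (rule ex1I)
  qed (elim conjE exE, rule decay)
qed

end
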